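(* Let $p,q$ be relatively prime positive integers, $L>0$, and $\varepsilon<\varepsilon(L)$. For any $B\in\mathbb{Z}_{\ge0}$ and any Reeb current $\alpha$ of $(S^3,\lambda_{p,q,\varepsilon})$ not including the right-handed $T(p,q)$ torus knot $\mathsf{b}$ (with $\mathsf{b}^B\alpha$ of action less than $L$), \[ \mathcal{F}_{\mathsf{b}}(\mathsf{b}^B\alpha)=d(\mathsf{b}^B\alpha)+B\delta_L, \] where $\delta_L>0$ is the small irrational number for which $\operatorname{rot}(\mathsf{b})=pq+\delta_L$.
   Context: **Contact forms.** On $S^3\subset\mathbb{C}^2$ let $\lambda_0=\frac i2\sum_{j=1}^2(z_jd\bar z_j-\bar z_jdz_j)$ and $\lambda_{p,q}=\frac{1}{2\pi}\frac{\lambda_0}{p|z_1|^2+q|z_2|^2}$. Its Reeb flow is the $S^1$-action $e^{2\pi it}\cdot(z_1,z_2)=(e^{2\pi ipt}z_1,e^{2\pi iqt}z_2)$, with quotient orbifold $\mathfrak{p}:S^3\to\mathbb{CP}^1_{p,q}$. Let $\mathcal{H}_{p,q}$ be an orbifold Morse–Smale function on $\mathbb{CP}^1_{p,q}$ with exactly four critical points: a nonsingular maximum, a nonsingular index 1 point, and index 0 points at the points of isotropy $\mathbb{Z}/p$ and $\mathbb{Z}/q$. Set $\lambda_{p,q,\varepsilon}=(1+\varepsilon\,\mathfrak{p}^*\mathcal{H}_{p,q})\lambda_{p,q}$. For each $L$ there is $\varepsilon(L)>0$ such that for $\varepsilon<\varepsilon(L)$ all Reeb orbits of $\lambda_{p,q,\varepsilon}$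 with action $<L$ are nondegenerate and are covers of the fibers over the critical points: $\mathsf{b}$ (elliptic, a $T(p,q)$ knot, over the maximum), $\mathsf{h}$ (positive hyperbolic, over the index 1 point), $\mathsf{p}$ and $\mathsf{q}$ (elliptic, over the points with isotropy $\mathbb{Z}/p$, $\mathbb{Z}/q$; $\mathsf{p}=\{z_2=0\}$, $\mathsf{q}=\{z_1=0\}$). **Reeb currents and degree.** A Reeb current is a finite product $\prod\alpha_i^{m_i}$ of distinct embedded Reeb orbits with multiplicities; those of action $<L$ have the form $\mathsf{b}^B\mathsf{h}^H\mathsf{p}^P\mathsf{q}^Q$, and the degree is $d(\mathsf{b}^B\mathsf{h}^H\mathsf{p}^P\mathsf{q}^Q)=pq(B+H)+qP+pQ$. **Knot filtration.** $\mathcal{F}_{\mathsf{b}}(\mathsf{b}^m\alpha)=m\operatorname{rot}(\mathsf{b})+\ell(\alpha,\mathsf{b})$, where $\ell(\alpha,\mathsf{b})=\sum_im_i\ell(\alpha_i,\mathsf{b})$ is the linking number and $\operatorname{rot}(\mathsf{b})$ is the rotation number of the linearized Reeb flow along $\mathsf{b}$ in the trivialization of $\xi|_{\mathsf{b}}$ in which a constant pushoff of $\mathsf{b}$ has linking number zero with $\mathsf{b}$. One has $\operatorname{rot}(\mathsf{b})=pq+\delta_L$ with $0<\delta_L\ll1$ irrational. *)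

theory Defs
  imports "HOL-Analysis.Analysis" "HOL-Library.Multiset"
begin

section \<open>Smooth maps and \<open>S\<^sup>3 \<subseteq> \<complex>\<^sup>2\<close>\<close>

text \<open>\<open>Ck_on\<close> and \<open>smooth_on\<close> are meant for open sets. Functions and forms on \<open>S\<^sup>3\<close> are differentiated by
  extending them to \<open>\<complex>\<^sup>2 - {0}\<close>; functions on \<open>S\<^sup>3\<close> are extended along the radial
  retraction \<^const>\<open>sgn\<close>.\<close>

primrec Ck_on :: "nat \<Rightarrow> 'a::real_normed_vector set \<Rightarrow> ('a \<Rightarrow> 'b::real_normed_vector) \<Rightarrow> bool" where
  "Ck_on 0 S f \<longleftrightarrow> continuous_on S f"
| "Ck_on (Suc k) S f \<longleftrightarrow>
    (\<exists>f'. (\<forall>x\<in>S. (f has_derivative f' x) (at x)) \<and> (\<forall>v. Ck_on k S (\<lambda>x. f' x v)))"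

definition smooth_on :: "'a::real_normed_vector set \<Rightarrow> ('a \<Rightarrow> 'b::real_normed_vector) \<Rightarrow> bool" where
  "smooth_on S f \<longleftrightarrow> (\<forall>k. Ck_on k S f)"

type_synonym C2 = "complex \<times> complex"
type_synonym one_form = "C2 \<Rightarrow> C2 \<Rightarrow> real"

abbreviation S3 :: "C2 set" where "S3 \<equiv> sphere 0 1"

definition tangent_S3 :: "C2 \<Rightarrow> C2 set" where
  "tangent_S3 z = {w. z \<bullet> w = 0}"

definition cscale :: "complex \<Rightarrow> C2 \<Rightarrow> C2" where
  "cscale c w = (c * fst w, c * snd w)"

definition coords :: "C2 \<Rightarrow> real^4" where
  "coords w = vector [Re (fst w), Im (fst w), Re (snd w), Im (snd w)]"

definition det4 :: "C2 \<Rightarrow> C2 \<Rightarrow> C2 \<Rightarrow> C2 \<Rightarrow> real" where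
  "det4 a b c d = det (vector [coords a, coords b, coords c, coords d] :: real^4^4)"

section \<open>Linking numbers in \<open>S\<^sup>3\<close>\<close>

definition stereo :: "C2 \<Rightarrow> C2 \<Rightarrow> C2" where
  "stereo N x = (1 / (1 - x \<bullet> N)) *\<^sub>R (x - (x \<bullet> N) *\<^sub>R N)"

text \<open>Gauss' linking integral of two disjoint smooth loops, parametrized over \<open>[0,S]\<close> and
  \<open>[0,T]\<close>, after stereographic projection to the Euclidean 3-space orthogonal to a pole \<open>N\<close> off
  both loops. With \<open>S\<^sup>3\<close> oriented as the boundary of the unit ball, the projection preserves
  orientation if a frame \<open>u, v, w\<close> of this 3-space is called positive when \<open>-N, u, v, w\<close> is
  a positive frame of \<open>\<complex>\<^sup>2\<close>. The value depends neither on \<open>N\<close> nor on the base points.\<close>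

definition linking_number :: "(real \<Rightarrow> C2) \<Rightarrow> real \<Rightarrow> (real \<Rightarrow> C2) \<Rightarrow> real \<Rightarrow> real" where
  "linking_number \<gamma> S \<eta> T =
    (let N = (SOME N. N \<in> S3 \<and> N \<notin> \<gamma> ` {0..S} \<and> N \<notin> \<eta> ` {0..T});
         c = (\<lambda>s. stereo N (\<gamma> s));
         d = (\<lambda>t. stereo N (\<eta> t))
     in 1 / (4 * pi) *
        integral (cbox (0, 0) (S, T))
          (\<lambda>(s, t). det4 (- N) (c s - d t) (vector_derivative c (at s)) (vector_derivative d (at t))
                     / norm (c s - d t) ^ 3))"

section \<open>Contact forms and Reeb orbits\<close>

text \<open>The exterior derivative, evaluated on constant vector fields.\<close>

definition ext_deriv :: "one_form \<Rightarrow> C2 \<Rightarrow> C2 \<Rightarrow> C2 \<Rightarrow> real" where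
  "ext_deriv lam z u v =
    frechet_derivative (\<lambda>x. lam x v) (at z) u - frechet_derivative (\<lambda>x. lam x u) (at z) v"

definition contact_form :: "one_form \<Rightarrow> bool" where
  "contact_form lam \<longleftrightarrow>
    (\<forall>z\<in>S3. \<forall>u\<in>tangent_S3 z. \<forall>v\<in>tangent_S3 z. \<forall>w\<in>tangent_S3 z. det4 z u v w > 0 \<longrightarrow>
       lam z u * ext_deriv lam z v w + lam z v * ext_deriv lam z w u + lam z w * ext_deriv lam z u v > 0)"

definition contact_plane :: "one_form \<Rightarrow> C2 \<Rightarrow> C2 set" where
  "contact_plane lam z = {w \<in> tangent_S3 z. lam z w = 0}"

definition is_reeb_vector :: "one_form \<Rightarrow> C2 \<Rightarrow> C2 \<Rightarrow> bool" where
  "is_reeb_vector lam z R \<longleftrightarrow>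
    R \<in> tangent_S3 z \<and> lam z R = 1 \<and> (\<forall>w\<in>tangent_S3 z. ext_deriv lam z R w = 0)"

definition reeb_trajectory :: "one_form \<Rightarrow> (real \<Rightarrow> C2) \<Rightarrow> bool" where
  "reeb_trajectory lam \<gamma> \<longleftrightarrow>
    (\<forall>t. \<gamma> t \<in> S3 \<and> (\<exists>R. is_reeb_vector lam (\<gamma> t) R \<and> (\<gamma> has_vector_derivative R) (at t)))"

definition reeb_flow :: "one_form \<Rightarrow> real \<Rightarrow> C2 \<Rightarrow> C2" where
  "reeb_flow lam t z = (SOME \<gamma>. reeb_trajectory lam \<gamma> \<and> \<gamma> 0 = z) t"

definition linearized_flow :: "one_form \<Rightarrow> real \<Rightarrow> C2 \<Rightarrow> C2 \<Rightarrow> C2" where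
  "linearized_flow lam t z v = frechet_derivative (\<lambda>x. reeb_flow lam t (sgn x)) (at z) v"

text \<open>A Reeb orbit, possibly multiply covered, given by a trajectory and a (not necessarily
  minimal) period.\<close>

definition reeb_orbit :: "one_form \<Rightarrow> (real \<Rightarrow> C2) \<Rightarrow> real \<Rightarrow> bool" where
  "reeb_orbit lam \<gamma> T \<longleftrightarrow> reeb_trajectory lam \<gamma> \<and> T > 0 \<and> (\<forall>t. \<gamma> (t + T) = \<gamma> t)"

definition action :: "one_form \<Rightarrow> (real \<Rightarrow> C2) \<Rightarrow> real \<Rightarrow> real" where
  "action lam \<gamma> T = integral {0..T} (\<lambda>t. lam (\<gamma> t) (vector_derivative \<gamma> (at t)))"

definition nondegenerate :: "one_form \<Rightarrow> (real \<Rightarrow> C2) \<Rightarrow> real \<Rightarrow> bool" where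
  "nondegenerate lam \<gamma> T \<longleftrightarrow>
    (\<forall>v\<in>contact_plane lam (\<gamma> 0). linearized_flow lam T (\<gamma> 0) v = v \<longrightarrow> v = 0)"

text \<open>An embedded Reeb orbit is identified with its image, which the Reeb vector field orients.\<close>

definition reeb_param :: "one_form \<Rightarrow> C2 set \<Rightarrow> (real \<Rightarrow> C2) \<Rightarrow> real \<Rightarrow> bool" where
  "reeb_param lam K \<gamma> T \<longleftrightarrow> reeb_orbit lam \<gamma> T \<and> inj_on \<gamma> {0..<T} \<and> range \<gamma> = K"

definition embedded_reeb_orbit :: "one_form \<Rightarrow> C2 set \<Rightarrow> bool" where
  "embedded_reeb_orbit lam K \<longleftrightarrow> (\<exists>\<gamma> T. reeb_param lam K \<gamma> T)"

definition some_param :: "one_form \<Rightarrow> C2 set \<Rightarrow> (real \<Rightarrow> C2) \<times> real" where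
  "some_param lam K = (SOME (\<gamma>, T). reeb_param lam K \<gamma> T)"

definition orbit_action :: "one_form \<Rightarrow> C2 set \<Rightarrow> real" where
  "orbit_action lam K = (case some_param lam K of (\<gamma>, T) \<Rightarrow> action lam \<gamma> T)"

definition orbit_linking :: "one_form \<Rightarrow> C2 set \<Rightarrow> C2 set \<Rightarrow> real" where
  "orbit_linking lam K K' =
    (case some_param lam K of (\<gamma>, S) \<Rightarrow> case some_param lam K' of (\<eta>, T) \<Rightarrow>
       linking_number \<gamma> S \<eta> T)"

text \<open>A Reeb current \<open>\<Prod>\<alpha>\<^sub>i\<^bsup>m\<^sub>i\<^esup>\<close> is the multiset containing each \<open>\<alpha>\<^sub>i\<close> with multiplicity
  \<open>m\<^sub>i\<close>; the product of currents is the sum of multisets.\<close>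

definition reeb_current :: "one_form \<Rightarrow> C2 set multiset \<Rightarrow> bool" where
  "reeb_current lam \<Gamma> \<longleftrightarrow> (\<forall>K\<in>#\<Gamma>. embedded_reeb_orbit lam K)"

definition current_action :: "one_form \<Rightarrow> C2 set multiset \<Rightarrow> real" where
  "current_action lam \<Gamma> = (\<Sum>K\<in>#\<Gamma>. orbit_action lam K)"

section \<open>Rotation number and knot filtration\<close>

text \<open>All contact forms below are multiples of \<open>\<lambda>\<^sub>0\<close>, so that the contact plane is a complex line
  in \<open>\<complex>\<^sup>2\<close> on which multiplication by \<open>\<i>\<close> is compatible with the orientation by
  \<open>d\<lambda>\<close>. A trivialization of it along an orbit is thus given by a nowhere vanishing section
  \<open>\<tau>\<close>, with \<open>c \<in> \<complex>\<close> corresponding to \<open>c \<tau>\<close>.\<close>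

definition linking_zero_trivialization ::
  "one_form \<Rightarrow> (real \<Rightarrow> C2) \<Rightarrow> real \<Rightarrow> (real \<Rightarrow> C2) \<Rightarrow> bool" where
  "linking_zero_trivialization lam \<gamma> T \<tau> \<longleftrightarrow>
    smooth_on UNIV \<tau> \<and>
    (\<forall>t. \<tau> t \<in> contact_plane lam (\<gamma> t) \<and> \<tau> t \<noteq> 0 \<and> \<tau> (t + T) = \<tau> t) \<and>
    (\<exists>s\<^sub>0>0. \<forall>s. 0 < s \<and> s < s\<^sub>0 \<longrightarrow> linking_number (\<lambda>t. sgn (\<gamma> t + s *\<^sub>R \<tau> t)) T \<gamma> T = 0)"

text \<open>\<open>2\<pi>\<theta>\<close> is a continuous argument, in the trivialization \<open>\<tau>\<close>, of a vector transported by the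
  linearized flow; the rotation number is its average increase in turns per period.\<close>

definition rotation_number :: "one_form \<Rightarrow> C2 set \<Rightarrow> real" where
  "rotation_number lam K =
    (THE r. \<exists>\<gamma> T \<tau> v \<theta>.
       reeb_param lam K \<gamma> T \<and> linking_zero_trivialization lam \<gamma> T \<tau> \<and>
       v \<in> contact_plane lam (\<gamma> 0) \<and> v \<noteq> 0 \<and>
       continuous_on UNIV \<theta> \<and>
       (\<forall>t. \<exists>\<rho>>0. linearized_flow lam t (\<gamma> 0) v = cscale (\<rho> *\<^sub>R cis (2 * pi * \<theta> t)) (\<tau> t)) \<and>
       (\<lambda>k. (\<theta> (real k * T) - \<theta> 0) / real k) \<longlonglongrightarrow> r)"

definition knot_filtration :: "one_form \<Rightarrow> C2 set \<Rightarrow> C2 set multiset \<Rightarrow> real" where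
  "knot_filtration lam b \<Gamma> =
    real (count \<Gamma> b) * rotation_number lam b
      + (\<Sum>K\<in>#filter_mset (\<lambda>K. K \<noteq> b) \<Gamma>. orbit_linking lam K b)"

section \<open>The orbifold \<open>\<complex>\<P>\<^sup>1\<^bsub>p,q\<^esub>\<close>\<close>

definition act :: "nat \<Rightarrow> nat \<Rightarrow> complex \<Rightarrow> C2 \<Rightarrow> C2" where
  "act p q c z = (c ^ p * fst z, c ^ q * snd z)"

text \<open>The points of the quotient are the orbits of the circle action; restricted to \<open>S\<^sup>3\<close>,
  \<open>fiber p q\<close> is the quotient map.\<close>

definition fiber :: "nat \<Rightarrow> nat \<Rightarrow> C2 \<Rightarrow> C2 set" where
  "fiber p q z = {act p q c z | c. norm c = 1}"

definition CP1 :: "nat \<Rightarrow> nat \<Rightarrow> C2 set set" where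
  "CP1 p q = fiber p q ` S3"

definition isotropy :: "nat \<Rightarrow> nat \<Rightarrow> C2 \<Rightarrow> complex set" where
  "isotropy p q z = {c. norm c = 1 \<and> act p q c z = z}"

definition nonsingular :: "nat \<Rightarrow> nat \<Rightarrow> C2 set \<Rightarrow> bool" where
  "nonsingular p q x \<longleftrightarrow> (\<forall>z\<in>x. isotropy p q z = {1})"

definition p_orbit :: "C2 set" where "p_orbit = {z \<in> S3. snd z = 0}"
definition q_orbit :: "C2 set" where "q_orbit = {z \<in> S3. fst z = 0}"

definition pullback :: "nat \<Rightarrow> nat \<Rightarrow> (C2 set \<Rightarrow> real) \<Rightarrow> C2 \<Rightarrow> real" where
  "pullback p q H z = H (fiber p q (sgn z))"

definition lambda0 :: one_form where
  "lambda0 z w =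
    Re (\<i> / 2 * ((fst z * cnj (fst w) - cnj (fst z) * fst w)
             + (snd z * cnj (snd w) - cnj (snd z) * snd w)))"

definition lambda_pq :: "nat \<Rightarrow> nat \<Rightarrow> one_form" where
  "lambda_pq p q z w =
    1 / (2 * pi) * (lambda0 z w / (real p * norm (fst z) ^ 2 + real q * norm (snd z) ^ 2))"

definition lambda_pqe :: "nat \<Rightarrow> nat \<Rightarrow> (C2 set \<Rightarrow> real) \<Rightarrow> real \<Rightarrow> one_form" where
  "lambda_pqe p q H \<epsilon> z w = (1 + \<epsilon> * pullback p q H z) * lambda_pq p q z w"

section \<open>Orbifold Morse--Smale functions\<close>

text \<open>Discs in \<open>S\<^sup>3\<close> through \<open>z\<close> tangent to \<open>contact_plane lambda0 z\<close> are transverse to the circle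
  action and serve as orbifold charts at \<open>fiber p q z\<close>. Hence orbifold functions, their
  derivatives and Hessians are those of the pullback, restricted to this plane; a smooth orbifold
  function is one with smooth pullback. Orbifold Riemannian metrics are invariant metrics on
  these planes.\<close>

definition critical_points :: "nat \<Rightarrow> nat \<Rightarrow> (C2 set \<Rightarrow> real) \<Rightarrow> C2 set set" where
  "critical_points p q H =
    {x \<in> CP1 p q. \<forall>z\<in>x. \<forall>v\<in>contact_plane lambda0 z. frechet_derivative (pullback p q H) (at z) v = 0}"

definition hessian :: "(C2 \<Rightarrow> real) \<Rightarrow> C2 \<Rightarrow> C2 \<Rightarrow> C2 \<Rightarrow> real" where
  "hessian F z u v = frechet_derivative (\<lambda>x. frechet_derivative F (at x) v) (at z) u"

definition nondegenerate_critical :: "nat \<Rightarrow> nat \<Rightarrow> (C2 set \<Rightarrow> real) \<Rightarrow> C2 set \<Rightarrow> bool" where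
  "nondegenerate_critical p q H x \<longleftrightarrow>
    (\<forall>z\<in>x. \<forall>u\<in>contact_plane lambda0 z.
       (\<forall>v\<in>contact_plane lambda0 z. hessian (pullback p q H) z u v = 0) \<longrightarrow> u = 0)"

definition has_index :: "nat \<Rightarrow> nat \<Rightarrow> (C2 set \<Rightarrow> real) \<Rightarrow> C2 set \<Rightarrow> nat \<Rightarrow> bool" where
  "has_index p q H x k \<longleftrightarrow>
    (\<forall>z\<in>x. k = Max {dim V | V. subspace V \<and> V \<subseteq> contact_plane lambda0 z \<and>
                       (\<forall>v\<in>V - {0}. hessian (pullback p q H) z v v < 0)})"

definition orbifold_metric :: "nat \<Rightarrow> nat \<Rightarrow> (C2 \<Rightarrow> C2 \<Rightarrow> C2 \<Rightarrow> real) \<Rightarrow> bool" where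
  "orbifold_metric p q g \<longleftrightarrow>
    (\<forall>u v. smooth_on (- {0}) (\<lambda>x. g (sgn x) u v)) \<and>
    (\<forall>z\<in>S3. bilinear (g z) \<and>
       (\<forall>u\<in>contact_plane lambda0 z. \<forall>v\<in>contact_plane lambda0 z.
          g z u v = g z v u \<and> (u \<noteq> 0 \<longrightarrow> g z u u > 0) \<and>
          (\<forall>c. norm c = 1 \<longrightarrow> g (act p q c z) (act p q c u) (act p q c v) = g z u v)))"

text \<open>Horizontal lifts to \<open>S\<^sup>3\<close> of the flow lines of the negative gradient.\<close>

definition gradient_line ::
  "nat \<Rightarrow> nat \<Rightarrow> (C2 set \<Rightarrow> real) \<Rightarrow> (C2 \<Rightarrow> C2 \<Rightarrow> C2 \<Rightarrow> real) \<Rightarrow> (real \<Rightarrow> C2) \<Rightarrow> bool" where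
  "gradient_line p q H g \<gamma> \<longleftrightarrow>
    (\<forall>t. \<gamma> t \<in> S3 \<and>
       (\<exists>G\<in>contact_plane lambda0 (\<gamma> t).
          (\<forall>w\<in>contact_plane lambda0 (\<gamma> t).
             g (\<gamma> t) G w = frechet_derivative (pullback p q H) (at (\<gamma> t)) w) \<and>
          (\<gamma> has_vector_derivative - G) (at t)))"

text \<open>Preimages in \<open>S\<^sup>3\<close> of the stable and unstable manifolds of a critical point.\<close>

definition stable_set ::
  "nat \<Rightarrow> nat \<Rightarrow> (C2 set \<Rightarrow> real) \<Rightarrow> (C2 \<Rightarrow> C2 \<Rightarrow> C2 \<Rightarrow> real) \<Rightarrow> C2 set \<Rightarrow> C2 set" where
  "stable_set p q H g x =
    {z. \<exists>\<gamma>. gradient_line p q H g \<gamma> \<and> \<gamma> 0 = z \<and> ((\<lambda>t. infdist (\<gamma> t) x) \<longlongrightarrow> 0) at_top}"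

definition unstable_set ::
  "nat \<Rightarrow> nat \<Rightarrow> (C2 set \<Rightarrow> real) \<Rightarrow> (C2 \<Rightarrow> C2 \<Rightarrow> C2 \<Rightarrow> real) \<Rightarrow> C2 set \<Rightarrow> C2 set" where
  "unstable_set p q H g x =
    {z. \<exists>\<gamma>. gradient_line p q H g \<gamma> \<and> \<gamma> 0 = z \<and> ((\<lambda>t. infdist (\<gamma> t) x) \<longlongrightarrow> 0) at_bot}"

definition tangent_vectors :: "C2 set \<Rightarrow> C2 \<Rightarrow> C2 set" where
  "tangent_vectors W z =
    {v. \<exists>c r. r > 0 \<and> smooth_on {-r<..<r} c \<and> c ` {-r<..<r} \<subseteq> W \<and> c 0 = z \<and>
          (c has_vector_derivative v) (at (0::real))}"

definition orbifold_morse_smale :: "nat \<Rightarrow> nat \<Rightarrow> (C2 set \<Rightarrow> real) \<Rightarrow> bool" where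
  "orbifold_morse_smale p q H \<longleftrightarrow>
    smooth_on (- {0}) (pullback p q H) \<and>
    (\<forall>x\<in>critical_points p q H. nondegenerate_critical p q H x) \<and>
    (\<exists>g. orbifold_metric p q g \<and>
       (\<forall>x\<in>critical_points p q H. \<forall>y\<in>critical_points p q H.
          \<forall>z\<in>unstable_set p q H g x \<inter> stable_set p q H g y.
            span (tangent_vectors (unstable_set p q H g x) z
                    \<union> tangent_vectors (stable_set p q H g y) z) = tangent_S3 z))"

text \<open>\<open>b\<close> and \<open>h\<close> are the fibers over the maximum and the index 1 point.\<close>

definition four_point_morse_smale ::
  "nat \<Rightarrow> nat \<Rightarrow> (C2 set \<Rightarrow> real) \<Rightarrow> C2 set \<Rightarrow> C2 set \<Rightarrow> bool" where
  "four_point_morse_smale p q H b h \<longleftrightarrow>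
    orbifold_morse_smale p q H \<and>
    critical_points p q H = {b, h, p_orbit, q_orbit} \<and> card {b, h, p_orbit, q_orbit} = 4 \<and>
    nonsingular p q b \<and> (\<forall>x\<in>CP1 p q. H x \<le> H b) \<and>
    nonsingular p q h \<and> has_index p q H h 1 \<and>
    has_index p q H p_orbit 0 \<and> has_index p q H q_orbit 0"

section \<open>Action threshold and degree\<close>

text \<open>The defining property of \<open>\<epsilon>(L)\<close>.\<close>

definition action_threshold :: "nat \<Rightarrow> nat \<Rightarrow> (C2 set \<Rightarrow> real) \<Rightarrow> real \<Rightarrow> real \<Rightarrow> bool" where
  "action_threshold p q H L \<epsilon>\<^sub>L \<longleftrightarrow>
    0 < \<epsilon>\<^sub>L \<and>
    (\<forall>\<epsilon>. 0 < \<epsilon> \<and> \<epsilon> < \<epsilon>\<^sub>L \<longrightarrow>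
       contact_form (lambda_pqe p q H \<epsilon>) \<and>
       (\<forall>\<gamma> T. reeb_orbit (lambda_pqe p q H \<epsilon>) \<gamma> T \<and> action (lambda_pqe p q H \<epsilon>) \<gamma> T < L \<longrightarrow>
          nondegenerate (lambda_pqe p q H \<epsilon>) \<gamma> T \<and> range \<gamma> \<in> critical_points p q H))"

definition degree :: "nat \<Rightarrow> nat \<Rightarrow> C2 set \<Rightarrow> C2 set \<Rightarrow> C2 set multiset \<Rightarrow> nat" where
  "degree p q b h \<Gamma> =
    p * q * (count \<Gamma> b + count \<Gamma> h) + q * count \<Gamma> p_orbit + p * count \<Gamma> q_orbit"

end

theory Submission
  imports Defs
begin

text \<open>
The knot filtration of \<open>b\<^sup>B \<alpha>\<close> is \<open>B\<close> times the rotation number \<open>p q + \<delta>\<close> plus the linking number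
of \<open>\<alpha>\<close> with \<open>b\<close>. Hence the theorem says that \<open>\<alpha>\<close> consists of the orbits \<open>h\<close>, \<open>p\<close> and \<open>q\<close>
only, and that these link \<open>b\<close> exactly \<open>p q\<close>, \<open>q\<close> and \<open>p\<close> times, as the degree prescribes.

The first claim holds because the action of an orbit is its period, a positive number: no orbit in
the current has more action than the current, so each orbit has action below \<open>L\<close> and lies over
one of the four critical points. Over a critical point the derivative of the perturbation vanishes,
and the Reeb vector field is the generator of the circle action divided by the constant
\<open>1 + \<epsilon> H\<close> (\<open>critical_reeb_vector\<close>, \<open>reeb_vector_unique\<close>). This constant is positive, since
otherwise \<open>\<epsilon>\<close> or some smaller value would produce a form with a zero (\<open>factor_positive\<close>), so that Reeb
orbits run through the fibers in the direction of the action
(\<open>reeb_trajectory_over_critical_point\<close>).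

The second claim is a computation of Gauss' integral for two fibers \<open>x\<close>, \<open>y\<close> and an arbitrary
pole \<open>N\<close> of the stereographic projection. In an orthonormal frame of the space orthogonal to \<open>N\<close>
the integral becomes the solid angle of the torus \<open>(s, t) \<mapsto> x s - y t\<close> in \<open>\<real>\<^sup>3 - {0}\<close>. It does
not change under homotopies of the torus which avoid the origin (\<open>solid_angle_homotopy\<close>),
because the solid angle form is closed. The pole is just a point on a third fiber, so a choice of
both curves and the pole amounts to three points of the quotient sphere, and these can be moved to
standard position without collision (\<open>knot_angle_eq\<close>). There the fibers are the two components
of the Hopf link, covered \<open>p\<close> and \<open>q\<close> times; their torus is homotopic to a torus that is almost
pinched at the origin, and in the limit of the pinching the integral is elementary
(\<open>solid_angle_pinched_torus_limit\<close>). Over one period of the action the result is \<open>p q\<close>. The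
\<open>p\<close> orbit is run through \<open>p\<close> times in one such period, so that it contributes \<open>q\<close>; symmetrically
the \<open>q\<close> orbit contributes \<open>p\<close>.
\<close>

section \<open>The solid angle of a torus\<close>

definition triple :: "real^3 \<Rightarrow> real^3 \<Rightarrow> real^3 \<Rightarrow> real" where
  "triple u v w = u \<bullet> cross3 v w"

text \<open>The area form of the unit sphere, pulled back to \<open>\<real>\<^sup>3 - {0}\<close> by radial projection.\<close>

definition solid_form :: "real^3 \<Rightarrow> real^3 \<Rightarrow> real^3 \<Rightarrow> real" where
  "solid_form x u v = triple x u v / norm x ^ 3"

text \<open>The derivative of \<open>solid_form x u v\<close> with respect to \<open>x\<close> in the direction \<open>e\<close>.\<close>

definition solid_form_deriv :: "real^3 \<Rightarrow> real^3 \<Rightarrow> real^3 \<Rightarrow> real^3 \<Rightarrow> real" where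
  "solid_form_deriv x e u v =
    triple e u v / norm x ^ 3 - 3 * (x \<bullet> e) * triple x u v / norm x ^ 5"

lemma triple_explicit:
  "triple u v w = u$1 * (v$2 * w$3 - v$3 * w$2) + u$2 * (v$3 * w$1 - v$1 * w$3) + u$3 * (v$1 * w$2 - v$2 * w$1)"
  by (simp add: triple_def cross3_def inner_vec_def sum_3)

text \<open>Multiplied by \<open>norm x ^ 5\<close>, and after sorting the determinants by antisymmetry, this is Cramer's
rule for the expansion of \<open>x\<close> in terms of \<open>a\<close>, \<open>b\<close> and \<open>c\<close>, paired with \<open>x\<close>.\<close>

lemma solid_form_closed:
  assumes "x \<noteq> 0"
  shows "solid_form_deriv x a b c = solid_form_deriv x b a c + solid_form_deriv x c b a"
proof -
  have id: "(norm x)\<^sup>2 * triple a b c = (x \<bullet> a) * triple x b c + (x \<bullet> b) * triple x c a + (x \<bullet> c) * triple x a b"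
    unfolding power2_norm_eq_inner
    by (simp add: triple_explicit inner_vec_def sum_3 algebra_simps)
  have sw: "triple b a c = - triple a b c" "triple c b a = - triple a b c"
    "triple x a c = - triple x c a" "triple x b a = - triple x a b"
    by (simp_all add: triple_explicit algebra_simps)
  have n: "norm x > 0" using assms by simp
  have e: "triple a b c / norm x ^ 3 = (norm x)\<^sup>2 * triple a b c / norm x ^ 5"
    using n by (simp add: field_simps eval_nat_numeral)
  show ?thesis
    unfolding solid_form_deriv_def sw minus_divide_left[symmetric] mult_minus_right e id
    using n by (simp add: field_simps)
qed

lemma bounded_bilinear_cross3: "bounded_bilinear cross3"
  using bilinear_conv_bounded_bilinear bilinear_cross by blast

lemma has_real_derivative_triple:
  assumes "(x has_vector_derivative x') (at \<tau>)" "(u has_vector_derivative u') (at \<tau>)"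
    "(v has_vector_derivative v') (at \<tau>)"
  shows "((\<lambda>\<tau>. triple (x \<tau>) (u \<tau>) (v \<tau>)) has_real_derivative
     triple x' (u \<tau>) (v \<tau>) + triple (x \<tau>) u' (v \<tau>) + triple (x \<tau>) (u \<tau>) v') (at \<tau>)"
  unfolding triple_def has_real_derivative_iff_has_vector_derivative
  using bounded_bilinear.has_vector_derivative[OF bounded_bilinear_inner assms(1)
      bounded_bilinear.has_vector_derivative[OF bounded_bilinear_cross3 assms(2,3)]]
  by (simp add: inner_add_right add_ac)

lemma has_real_derivative_norm_cube:
  fixes x :: "real \<Rightarrow> 'a::real_inner"
  assumes "(x has_vector_derivative x') (at \<tau>)" "x \<tau> \<noteq> 0"
  shows "((\<lambda>\<tau>. norm (x \<tau>) ^ 3) has_real_derivative 3 * norm (x \<tau>) * (x \<tau> \<bullet> x')) (at \<tau>)"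
proof -
  have "((\<lambda>\<tau>. x \<tau> \<bullet> x \<tau>) has_real_derivative 2 * (x \<tau> \<bullet> x')) (at \<tau>)"
    unfolding has_real_derivative_iff_has_vector_derivative
    using bounded_bilinear.has_vector_derivative[OF bounded_bilinear_inner assms(1) assms(1)]
    by (simp add: inner_commute)
  from DERIV_power[OF DERIV_chain2[OF DERIV_real_sqrt this], of 3]
  have "((\<lambda>\<tau>. sqrt (x \<tau> \<bullet> x \<tau>) ^ 3) has_real_derivative
     3 * (inverse (sqrt (x \<tau> \<bullet> x \<tau>)) / 2 * (2 * (x \<tau> \<bullet> x')) * sqrt (x \<tau> \<bullet> x \<tau>) ^ 2)) (at \<tau>)"
    using assms(2) by (simp add: eval_nat_numeral)
  moreover have "3 * (inverse (sqrt (x \<tau> \<bullet> x \<tau>)) / 2 * (2 * (x \<tau> \<bullet> x')) * sqrt (x \<tau> \<bullet> x \<tau>) ^ 2)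
      = 3 * norm (x \<tau>) * (x \<tau> \<bullet> x')"
    using assms(2) by (simp add: norm_eq_sqrt_inner power2_eq_square del: real_sqrt_mult_self)
  ultimately show ?thesis by (simp only: norm_eq_sqrt_inner)
qed

lemma has_real_derivative_solid_form:
  assumes "(x has_vector_derivative x') (at \<tau>)" "(u has_vector_derivative u') (at \<tau>)"
    "(v has_vector_derivative v') (at \<tau>)" "x \<tau> \<noteq> 0"
  shows "((\<lambda>\<tau>. solid_form (x \<tau>) (u \<tau>) (v \<tau>)) has_real_derivative
     solid_form_deriv (x \<tau>) x' (u \<tau>) (v \<tau>) + solid_form (x \<tau>) u' (v \<tau>) + solid_form (x \<tau>) (u \<tau>) v') (at \<tau>)"
  unfolding solid_form_def
  by (rule DERIV_cong[OF DERIV_divide[OF has_real_derivative_triple[OF assms(1-3)] has_real_derivative_norm_cube[OF assms(1,4)]]])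
     (use assms(4) in \<open>simp_all add: solid_form_deriv_def field_simps eval_nat_numeral\<close>)

text \<open>The only second derivative that enters the homotopy invariance is the mixed one. Listing the
derivatives, with the same function for both orders of differentiation, makes its symmetry part of
the definition.\<close>

definition torus_derivs ::
  "(real \<Rightarrow> real \<Rightarrow> real^3) \<Rightarrow> (real \<Rightarrow> real \<Rightarrow> real^3) \<Rightarrow> (real \<Rightarrow> real \<Rightarrow> real^3) \<Rightarrow>
   (real \<Rightarrow> real \<Rightarrow> real^3) \<Rightarrow> bool" where
  "torus_derivs G Gs Gt Gst \<longleftrightarrow>
    (\<forall>s t. ((\<lambda>s. G s t) has_vector_derivative Gs s t) (at s)) \<and>
    (\<forall>s t. (G s has_vector_derivative Gt s t) (at t)) \<and>
    (\<forall>s t. ((\<lambda>s. Gt s t) has_vector_derivative Gst s t) (at s)) \<and>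
    (\<forall>s t. (Gs s has_vector_derivative Gst s t) (at t)) \<and>
    (\<forall>s t. G (s + 1) t = G s t \<and> G s (t + 1) = G s t) \<and>
    continuous_on UNIV (\<lambda>z. G (fst z) (snd z)) \<and>
    continuous_on UNIV (\<lambda>z. Gs (fst z) (snd z)) \<and>
    continuous_on UNIV (\<lambda>z. Gt (fst z) (snd z)) \<and>
    continuous_on UNIV (\<lambda>z. Gst (fst z) (snd z))"

text \<open>For \<open>G\<close> without zeros, this is \<open>4 \<pi>\<close> times the degree of \<open>G / norm G\<close> as a map from the torus to the
sphere.\<close>

definition solid_angle :: "(real \<Rightarrow> real \<Rightarrow> real^3) \<Rightarrow> real" where
  "solid_angle G = integral (cbox (0, 0) (1, 1))
    (\<lambda>(s, t). solid_form (G s t) (vector_derivative (\<lambda>s. G s t) (at s)) (vector_derivative (G s) (at t)))"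

lemma solid_angle_derivs:
  assumes "torus_derivs G Gs Gt Gst"
  shows "solid_angle G = integral (cbox (0, 0) (1, 1)) (\<lambda>(s, t). solid_form (G s t) (Gs s t) (Gt s t))"
proof -
  have "vector_derivative (\<lambda>s. G s t) (at s) = Gs s t" "vector_derivative (G s) (at t) = Gt s t" for s t
    using assms by (auto simp: torus_derivs_def intro: vector_derivative_at)
  then show ?thesis by (simp add: solid_angle_def)
qed

lemma torus_derivs_periodic:
  assumes "torus_derivs G Gs Gt Gst"
  shows "Gt (s + 1) t = Gt s t" "Gs s (t + 1) = Gs s t"
proof -
  have "G (s + 1) = G s" "(\<lambda>s. G s (t + 1)) = (\<lambda>s. G s t)"
    using assms by (auto simp: torus_derivs_def)
  then show "Gt (s + 1) t = Gt s t" "Gs s (t + 1) = Gs s t"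
    using assms unfolding torus_derivs_def by (metis vector_derivative_unique_at)+
qed

lemma continuous_on_pair_apply:
  assumes "continuous_on UNIV (\<lambda>z. G (fst z) (snd z))" "continuous_on A f" "continuous_on A g"
  shows "continuous_on A (\<lambda>x. G (f x) (g x))"
  using continuous_on_compose2[OF assms(1) continuous_on_Pair[OF assms(2,3)]] by simp

lemma continuous_on_triple [continuous_intros]:
  fixes x :: "'a::t2_space \<Rightarrow> real^3"
  assumes "continuous_on A x" "continuous_on A u" "continuous_on A v"
  shows "continuous_on A (\<lambda>z. triple (x z) (u z) (v z))"
  unfolding triple_def by (intro continuous_intros continuous_on_cross assms)

lemma continuous_on_solid_form [continuous_intros]:
  fixes x :: "'a::t2_space \<Rightarrow> real^3"
  assumes "continuous_on A x" "continuous_on A u" "continuous_on A v" "\<And>z. z \<in> A \<Longrightarrow> x z \<noteq> 0"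
  shows "continuous_on A (\<lambda>z. solid_form (x z) (u z) (v z))"
  unfolding solid_form_def using assms by (intro continuous_intros) auto

lemma continuous_on_solid_form_deriv [continuous_intros]:
  fixes x :: "'a::t2_space \<Rightarrow> real^3"
  assumes "continuous_on A x" "continuous_on A e" "continuous_on A u" "continuous_on A v" "\<And>z. z \<in> A \<Longrightarrow> x z \<noteq> 0"
  shows "continuous_on A (\<lambda>z. solid_form_deriv (x z) (e z) (u z) (v z))"
  unfolding solid_form_deriv_def using assms by (intro continuous_intros) auto

text \<open>Integrating in the direction of differentiation first leaves the difference of two equal boundary
values.\<close>

lemma integral_unit_square_periodic_deriv:
  fixes P :: "real \<Rightarrow> real \<Rightarrow> real"
  assumes der: "\<And>s t. s \<in> {0..1} \<Longrightarrow> t \<in> {0..1} \<Longrightarrow> ((\<lambda>s. P s t) has_real_derivative D s t) (at s)"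
    and cont: "continuous_on (cbox (0,0) (1,1)) (\<lambda>(s,t). D s t)"
    and per: "\<And>t. P 1 t = P 0 t"
  shows "integral (cbox (0,0) (1,1)) (\<lambda>(s,t). D s t) = 0"
proof -
  have "integral (cbox (0,0) (1,1)) (\<lambda>(s,t). D s t)
      = integral {0..1} (\<lambda>s. integral {0..1} (\<lambda>t. D s t))"
    using integral_prod_continuous[OF cont] by simp
  also have "\<dots> = integral {0..1} (\<lambda>t. integral {0..1} (\<lambda>s. D s t))"
    using integral_swap_continuous[OF cont] by simp
  also have "\<dots> = integral {0..1::real} (\<lambda>t. 0)"
  proof (rule Henstock_Kurzweil_Integration.integral_cong)
    fix t :: real assume "t \<in> {0..1}"
    then have "((\<lambda>s. D s t) has_integral P 1 t - P 0 t) {0..1}"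
      by (intro fundamental_theorem_of_calculus)
         (auto intro: has_field_derivative_at_within[OF der] simp: has_real_derivative_iff_has_vector_derivative[symmetric])
    then show "integral {0..1} (\<lambda>s. D s t) = 0" by (simp add: integral_unique per)
  qed
  finally show ?thesis by simp
qed

lemma integral_unit_square_swap:
  fixes D :: "real \<Rightarrow> real \<Rightarrow> real"
  assumes "continuous_on (cbox (0,0) (1,1)) (\<lambda>(s,t). D s t)"
  shows "integral (cbox (0,0) (1,1)) (\<lambda>(s,t). D s t) = integral (cbox (0,0) (1,1)) (\<lambda>(t,s). D s t)"
  using integral_prod_continuous[OF assms] integral_swap_continuous[OF assms]
    integral_prod_continuous[OF swap_continuous[OF assms]] by simp

text \<open>Let \<open>\<omega>\<close> be the solid angle form, \<open>W\<close> the homotopy and \<open>V\<close> its derivative in the parameter \<open>r\<close>.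
As \<open>\<omega>\<close> is closed, the derivative of \<open>\<omega>(W\<^sub>s, W\<^sub>t)\<close> in \<open>r\<close> is the divergence
\<open>\<partial>\<^sub>s (\<omega>(V, W\<^sub>t)) + \<partial>\<^sub>t (\<omega>(W\<^sub>s, V))\<close>, and both summands integrate to zero over the torus.\<close>

lemma solid_angle_linear_homotopy:
  assumes G: "torus_derivs G Gs Gt Gst" and H: "torus_derivs H Hs Ht Hst"
    and nz: "\<And>r s t. r \<in> {0..1} \<Longrightarrow> s \<in> {0..1} \<Longrightarrow> t \<in> {0..1} \<Longrightarrow>
      G s t + r *\<^sub>R (H s t - G s t) \<noteq> 0"
  shows "solid_angle G = solid_angle H"
proof -
  define V Vs Vt where "V s t = H s t - G s t" and "Vs s t = Hs s t - Gs s t"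
    and "Vt s t = Ht s t - Gt s t" for s t
  define W Ws Wt Wst where "W r s t = G s t + r *\<^sub>R V s t" and "Ws r s t = Gs s t + r *\<^sub>R Vs s t"
    and "Wt r s t = Gt s t + r *\<^sub>R Vt s t" and "Wst r s t = Gst s t + r *\<^sub>R (Hst s t - Gst s t)" for r s t
  note defs = W_def Ws_def Wt_def Wst_def V_def Vs_def Vt_def
  let ?U = "{0..1::real}" and ?Q = "cbox (0::real,0::real) (1,1)"
  have Gd: "((\<lambda>s. G s t) has_vector_derivative Gs s t) (at s)" "(G s has_vector_derivative Gt s t) (at t)"
    "((\<lambda>s. Gt s t) has_vector_derivative Gst s t) (at s)" "(Gs s has_vector_derivative Gst s t) (at t)"
    "G (s + 1) t = G s t" "G s (t + 1) = G s t" for s t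
    using G by (auto simp: torus_derivs_def)
  have Hd: "((\<lambda>s. H s t) has_vector_derivative Hs s t) (at s)" "(H s has_vector_derivative Ht s t) (at t)"
    "((\<lambda>s. Ht s t) has_vector_derivative Hst s t) (at s)" "(Hs s has_vector_derivative Hst s t) (at t)"
    "H (s + 1) t = H s t" "H s (t + 1) = H s t" for s t
    using H by (auto simp: torus_derivs_def)
  have Wr: "((\<lambda>r. W r s t) has_vector_derivative V s t) (at r)"
    "((\<lambda>r. Ws r s t) has_vector_derivative Vs s t) (at r)"
    "((\<lambda>r. Wt r s t) has_vector_derivative Vt s t) (at r)" for r s t
    unfolding defs by (auto intro!: derivative_eq_intros)
  have Wd: "((\<lambda>s. W r s t) has_vector_derivative Ws r s t) (at s)"
    "((\<lambda>t. W r s t) has_vector_derivative Wt r s t) (at t)"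
    "((\<lambda>s. Wt r s t) has_vector_derivative Wst r s t) (at s)"
    "((\<lambda>t. Ws r s t) has_vector_derivative Wst r s t) (at t)"
    "((\<lambda>s. V s t) has_vector_derivative Vs s t) (at s)"
    "((\<lambda>t. V s t) has_vector_derivative Vt s t) (at t)" for r s t
    unfolding defs by (auto intro!: derivative_eq_intros Gd Hd)
  have nz': "W r s t \<noteq> 0" if "r \<in> ?U" "s \<in> ?U" "t \<in> ?U" for r s t
    using nz[OF that] by (simp add: defs)
  define Ds Dt where
    "Ds r s t = solid_form_deriv (W r s t) (Ws r s t) (V s t) (Wt r s t)
        + solid_form (W r s t) (Vs s t) (Wt r s t) + solid_form (W r s t) (V s t) (Wst r s t)"
    and "Dt r s t = solid_form_deriv (W r s t) (Wt r s t) (Ws r s t) (V s t)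
        + solid_form (W r s t) (Wst r s t) (V s t) + solid_form (W r s t) (Ws r s t) (Vt s t)" for r s t
  have Ds: "((\<lambda>s. solid_form (W r s t) (V s t) (Wt r s t)) has_real_derivative Ds r s t) (at s)"
    and Dt: "((\<lambda>t. solid_form (W r s t) (Ws r s t) (V s t)) has_real_derivative Dt r s t) (at t)"
    if "r \<in> ?U" "s \<in> ?U" "t \<in> ?U" for r s t
    unfolding Ds_def Dt_def using nz'[OF that] by (intro has_real_derivative_solid_form Wd; simp)+
  have alt: "solid_form x u v + solid_form x v u = 0" for x u v
    by (simp add: solid_form_def triple_explicit add_divide_distrib[symmetric] algebra_simps)
  have Dr: "((\<lambda>r. solid_form (W r s t) (Ws r s t) (Wt r s t)) has_real_derivative Ds r s t + Dt r s t) (at r)"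
    if "r \<in> ?U" "s \<in> ?U" "t \<in> ?U" for r s t
    using solid_form_closed[OF nz'[OF that], of "V s t" "Ws r s t" "Wt r s t"]
      alt[of "W r s t" "V s t" "Wst r s t"]
    by (intro DERIV_cong[OF has_real_derivative_solid_form[OF Wr nz'[OF that]]])
       (simp add: Ds_def Dt_def)
  have cG: "continuous_on UNIV (\<lambda>z. F (fst z) (snd z))" if "F \<in> {G, Gs, Gt, Gst, H, Hs, Ht, Hst}" for F
    using G H that unfolding torus_derivs_def by auto
  note ci = continuous_on_pair_apply[OF cG]
  have cf: "continuous_on ?Q (\<lambda>(s,t). solid_form (W r s t) (Ws r s t) (Wt r s t))" if "r \<in> ?U" for r
    unfolding split_beta
  proof (intro continuous_on_solid_form)
    show "W r (fst z) (snd z) \<noteq> 0" if "z \<in> ?Q" for z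
      using nz'[OF \<open>r \<in> ?U\<close>] that by (auto simp: mem_Times_iff cbox_Pair_eq)
  qed (unfold defs, (intro continuous_intros ci; simp)+)
  have cDs: "continuous_on (?U \<times> ?Q) (\<lambda>z. Ds (fst z) (fst (snd z)) (snd (snd z)))"
    and cDt: "continuous_on (?U \<times> ?Q) (\<lambda>z. Dt (fst z) (fst (snd z)) (snd (snd z)))"
  proof -
    have n: "W (fst z) (fst (snd z)) (snd (snd z)) \<noteq> 0" if "z \<in> ?U \<times> ?Q" for z
      using nz' that by (auto simp: mem_Times_iff cbox_Pair_eq)
    have c: "continuous_on (?U \<times> ?Q) (\<lambda>z. W (fst z) (fst (snd z)) (snd (snd z)))"
       "continuous_on (?U \<times> ?Q) (\<lambda>z. Ws (fst z) (fst (snd z)) (snd (snd z)))"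
       "continuous_on (?U \<times> ?Q) (\<lambda>z. Wt (fst z) (fst (snd z)) (snd (snd z)))"
       "continuous_on (?U \<times> ?Q) (\<lambda>z. Wst (fst z) (fst (snd z)) (snd (snd z)))"
       "continuous_on (?U \<times> ?Q) (\<lambda>z. V (fst (snd z)) (snd (snd z)))"
       "continuous_on (?U \<times> ?Q) (\<lambda>z. Vs (fst (snd z)) (snd (snd z)))"
       "continuous_on (?U \<times> ?Q) (\<lambda>z. Vt (fst (snd z)) (snd (snd z)))"
      unfolding defs by (intro continuous_intros ci; simp)+
    show "continuous_on (?U \<times> ?Q) (\<lambda>z. Ds (fst z) (fst (snd z)) (snd (snd z)))"
      unfolding Ds_def by (intro continuous_on_add continuous_on_solid_form continuous_on_solid_form_deriv c n)
    show "continuous_on (?U \<times> ?Q) (\<lambda>z. Dt (fst z) (fst (snd z)) (snd (snd z)))"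
      unfolding Dt_def by (intro continuous_on_add continuous_on_solid_form continuous_on_solid_form_deriv c n)
  qed
  have slice: "continuous_on ?Q (\<lambda>z. D r (fst z) (snd z))"
    if "continuous_on (?U \<times> ?Q) (\<lambda>z. D (fst z) (fst (snd z)) (snd (snd z)))" "r \<in> ?U"
    for r and D :: "real \<Rightarrow> real \<Rightarrow> real \<Rightarrow> real"
    using continuous_on_compose2[OF that(1) continuous_on_Pair[OF continuous_on_const[of ?Q r] continuous_on_id]] that(2)
    by (simp add: image_subset_iff)
  let ?f = "\<lambda>r (s, t). solid_form (W r s t) (Ws r s t) (Wt r s t)"
  let ?fx = "\<lambda>r (s, t). Ds r s t + Dt r s t"
  have zero: "integral ?Q (?fx r) = 0" if r: "r \<in> ?U" for r
  proof -
    have cs: "continuous_on ?Q (\<lambda>(s,t). Ds r s t)" and ct: "continuous_on ?Q (\<lambda>(s,t). Dt r s t)"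
      using slice[OF cDs r] slice[OF cDt r] by (simp_all add: split_beta)
    have "integral ?Q (\<lambda>(s,t). Ds r s t) = 0"
      using torus_derivs_periodic[OF G, of 0] torus_derivs_periodic[OF H, of 0] Gd(5)[of 0] Hd(5)[of 0]
      by (intro integral_unit_square_periodic_deriv[OF Ds[OF r] cs]) (auto simp: defs)
    moreover have "integral ?Q (\<lambda>(t,s). Dt r s t) = 0"
      using torus_derivs_periodic[OF G, of _ 0] torus_derivs_periodic[OF H, of _ 0] Gd(6)[of _ 0] Hd(6)[of _ 0] swap_continuous[OF ct]
      by (intro integral_unit_square_periodic_deriv[where D="\<lambda>t s. Dt r s t", OF Dt[OF r]]) (auto simp: defs)
    ultimately have "integral ?Q (\<lambda>z. (\<lambda>(s,t). Ds r s t) z + (\<lambda>(s,t). Dt r s t) z) = 0"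
      using integral_unit_square_swap[OF ct]
      by (subst integral_add) (auto intro: integrable_continuous cs ct)
    moreover have "?fx r = (\<lambda>z. (\<lambda>(s,t). Ds r s t) z + (\<lambda>(s,t). Dt r s t) z)"
      by (rule ext) (simp add: split_beta)
    ultimately show ?thesis by simp
  qed
  have deriv: "((\<lambda>r. integral ?Q (?f r)) has_field_derivative 0) (at r within ?U)" if r: "r \<in> ?U" for r
  proof -
    have "((\<lambda>r. integral ?Q (?f r)) has_field_derivative integral ?Q (?fx r)) (at r within ?U)"
    proof (rule leibniz_rule_field_derivative)
      show "((\<lambda>r. ?f r z) has_field_derivative ?fx x z) (at x within ?U)" if "x \<in> ?U" "z \<in> ?Q" for x z
      proof -
        obtain s t where z: "z = (s, t)" by (cases z)
        with that have "s \<in> ?U" "t \<in> ?U" by (auto simp: cbox_Pair_eq)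
        from has_field_derivative_at_within[OF Dr[OF that(1) this]] show ?thesis
          by (simp add: z)
      qed
      show "?f x integrable_on ?Q" if "x \<in> ?U" for x
        by (rule integrable_continuous[OF cf[OF that]])
      show "continuous_on (?U \<times> ?Q) (\<lambda>(x, z). ?fx x z)"
        using continuous_on_add[OF cDs cDt] by (simp add: split_beta)
    qed (use r in auto)
    then show ?thesis by (simp add: zero[OF r])
  qed
  have "\<exists>c. \<forall>r\<in>?U. integral ?Q (?f r) = c"
    by (rule has_field_derivative_zero_constant[OF _ deriv]) auto
  then obtain c where c: "\<And>r. r \<in> ?U \<Longrightarrow> integral ?Q (?f r) = c"
    by blast
  show ?thesis
    using c[of 0] c[of 1] unfolding solid_angle_derivs[OF G] solid_angle_derivs[OF H]
    by (simp add: defs)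
qed

text \<open>A continuous homotopy is a chain of linear ones: by compactness it stays away from the origin by
some \<open>e > 0\<close> and moves by less than \<open>e\<close> in a short interval of parameters, so that the segments between
successive tori miss the origin.\<close>

lemma solid_angle_homotopy:
  fixes F :: "real \<Rightarrow> real \<Rightarrow> real \<Rightarrow> real^3"
  assumes tor: "\<And>r. r \<in> {0..1} \<Longrightarrow> \<exists>Gs Gt Gst. torus_derivs (F r) Gs Gt Gst"
    and cont: "continuous_on ({0..1} \<times> {0..1} \<times> {0..1}) (\<lambda>(r, s, t). F r s t)"
    and nz: "\<And>r s t. r \<in> {0..1} \<Longrightarrow> s \<in> {0..1} \<Longrightarrow> t \<in> {0..1} \<Longrightarrow> F r s t \<noteq> 0"
  shows "solid_angle (F 0) = solid_angle (F 1)"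
proof -
  let ?C = "{0..1::real} \<times> {0..1::real} \<times> {0..1::real}"
  have comp: "compact ?C" by (intro compact_Times compact_Icc)
  have "continuous_on ?C (\<lambda>z. norm (case z of (r, s, t) \<Rightarrow> F r s t))"
    by (intro continuous_intros cont)
  from continuous_attains_inf[OF comp _ this]
  obtain z0 where z0: "z0 \<in> ?C" "\<And>z. z \<in> ?C \<Longrightarrow>
      norm (case z0 of (r, s, t) \<Rightarrow> F r s t) \<le> norm (case z of (r, s, t) \<Rightarrow> F r s t)"
    by auto
  define e where "e = norm (case z0 of (r, s, t) \<Rightarrow> F r s t)"
  have e: "e > 0" using z0(1) nz by (auto simp: e_def)
  have le: "e \<le> norm (F r s t)" if "r \<in> {0..1}" "s \<in> {0..1}" "t \<in> {0..1}" for r s t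
    using z0(2)[of "(r,s,t)"] that by (simp add: e_def)
  from compact_uniformly_continuous[OF cont comp] e
  obtain d where d: "d > 0" "\<And>z w. z \<in> ?C \<Longrightarrow> w \<in> ?C \<Longrightarrow> dist w z < d \<Longrightarrow>
      dist (case w of (r, s, t) \<Rightarrow> F r s t) (case z of (r, s, t) \<Rightarrow> F r s t) < e"
    unfolding uniformly_continuous_on_def by metis
  obtain n :: nat where n: "n > 0" "1 / real n < d"
    using d(1) by (metis nat_approx_posE zero_less_Suc)
  have "k \<le> n \<Longrightarrow> solid_angle (F (real k / real n)) = solid_angle (F 0)" for k
  proof (induction k)
    case (Suc k)
    let ?a = "real k / real n" and ?b = "real (Suc k) / real n"
    have ab: "?a \<in> {0..1}" "?b \<in> {0..1}" using Suc.prems n by (auto simp: divide_simps)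
    obtain Gs Gt Gst where G: "torus_derivs (F ?a) Gs Gt Gst" using tor[OF ab(1)] by blast
    obtain Hs Ht Hst where H: "torus_derivs (F ?b) Hs Ht Hst" using tor[OF ab(2)] by blast
    have "solid_angle (F ?a) = solid_angle (F ?b)"
    proof (rule solid_angle_linear_homotopy[OF G H])
      fix r s t :: real assume r: "r \<in> {0..1}" and st: "s \<in> {0..1}" "t \<in> {0..1}"
      have "dist (?b, s, t) (?a, s, t) = 1 / real n"
        using n by (simp add: dist_Pair_Pair dist_real_def diff_divide_distrib[symmetric])
      then have "dist (F ?b s t) (F ?a s t) < e"
        using d(2)[of "(?a, s, t)" "(?b, s, t)"] ab st n by auto
      then have "norm (r *\<^sub>R (F ?b s t - F ?a s t)) < norm (F ?a s t)"
        using le[OF ab(1) st] r mult_left_le_one_le[of "norm (F ?b s t - F ?a s t)" r]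
        by (auto simp: dist_norm)
      then show "F ?a s t + r *\<^sub>R (F ?b s t - F ?a s t) \<noteq> 0"
        by (metis add_eq_0_iff norm_minus_cancel order_less_irrefl)
    qed
    then show ?case using Suc by simp
  qed simp
  from this[of n] n show ?thesis by simp
qed

section \<open>A pinched torus\<close>

lemma vector3_decomp:
  "(vector [a, b, c] :: real^3) = a *\<^sub>R axis 1 1 + b *\<^sub>R axis 2 1 + c *\<^sub>R axis 3 1"
  by (simp add: vec_eq_iff forall_3 axis_def)

lemma has_vector_derivative_vector3:
  assumes "(a has_real_derivative a') (at x)" "(b has_real_derivative b') (at x)"
    "(c has_real_derivative c') (at x)"
  shows "((\<lambda>x. vector [a x, b x, c x] :: real^3) has_vector_derivative vector [a', b', c']) (at x)"
  unfolding vector3_decomp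
  by (auto intro!: derivative_eq_intros assms simp: has_real_derivative_iff_has_vector_derivative[symmetric])

lemma continuous_on_vector3 [continuous_intros]:
  fixes a b c :: "'a::topological_space \<Rightarrow> real"
  assumes "continuous_on A a" "continuous_on A b" "continuous_on A c"
  shows "continuous_on A (\<lambda>x. vector [a x, b x, c x] :: real^3)"
  unfolding vector3_decomp by (intro continuous_intros assms)

lemma periodic_nat:
  assumes "\<And>s::real. f (s + c) = f s"
  shows "f (s + real n * c) = f s"
proof (induction n)
  case (Suc n)
  then show ?case using assms[of "s + real n * c"] by (simp add: algebra_simps)
qed simp

lemma integral_subdivide_periodic:
  fixes f :: "real \<Rightarrow> real"
  assumes cont: "continuous_on UNIV f" and per: "\<And>x. f (x + c) = f x" and c: "c > 0"
  shows "integral {0..real n * c} f = real n * integral {0..c} f"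
proof (induction n)
  case (Suc n)
  have int: "f integrable_on {a..b}" for a b
    by (intro integrable_continuous_interval continuous_on_subset[OF cont]) auto
  have "(f has_integral integral {0..c} f) {0..c}" by (rule integrable_integral[OF int])
  then have "(f has_integral integral {0..c} f) {real n * c..real n * c + c}"
    using has_integral_shift_Icc_real[of f "real n * c" "integral {0..c} f" 0 c] periodic_nat[of f, OF per]
    by (simp add: add.commute o_def)
  moreover have "{real n * c..real n * c + c} = {real n * c..real (Suc n) * c}"
    by (simp add: algebra_simps)
  ultimately have "integral {real n * c..real (Suc n) * c} f = integral {0..c} f"
    by (simp add: integral_unique)
  moreover have "integral {0..real (Suc n) * c} f
      = integral {0..real n * c} f + integral {real n * c..real (Suc n) * c} f"
    using c int by (intro Henstock_Kurzweil_Integration.integral_combine[symmetric])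
      (auto intro!: mult_right_mono)
  ultimately show ?case using Suc by (simp add: algebra_simps)
qed simp

text \<open>In an orthonormal basis and up to the factor \<open>sqrt 2\<close>, this is
\<open>(sin S, - u sin T, - u cos T - \<kappa>)\<close>. For \<open>\<kappa> = 0\<close> it is a horn torus, swept out by the circles of
radius \<open>u = 1 - cos S\<close> around the first axis and pinched at the origin; a small \<open>\<kappa> > 0\<close> shifts the pinch
point away, so that the origin comes to lie inside the tube. The basis is the one in which the Hopf link
appears in the coordinates \<open>frame N\<close> below.\<close>

definition pinched_torus :: "nat \<Rightarrow> nat \<Rightarrow> real \<Rightarrow> real \<Rightarrow> real \<Rightarrow> real^3" where
  "pinched_torus p q \<kappa> s t = (let S = 2 * pi * p * s; T = 2 * pi * q * t; u = 1 - cos S in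
     vector [sin S - u * sin T, - sqrt 2 * (u * cos T + \<kappa>), - sin S - u * sin T])"

lemma sin_cos_nat_periodic:
  "sin (2 * pi * real n * (s + 1)) = sin (2 * pi * real n * s)"
  "cos (2 * pi * real n * (s + 1)) = cos (2 * pi * real n * s)"
proof -
  have "2 * pi * real n * (s + 1) = 2 * pi * real n * s + 2 * real n * pi" by (simp add: algebra_simps)
  moreover have "sin (x + 2 * real n * pi) = sin x" "cos (x + 2 * real n * pi) = cos x" for x
    by (simp_all add: sin_add cos_add)
  ultimately show "sin (2 * pi * real n * (s + 1)) = sin (2 * pi * real n * s)"
    "cos (2 * pi * real n * (s + 1)) = cos (2 * pi * real n * s)" by simp_all
qed

lemma torus_derivs_pinched_torus:
  fixes p q :: nat and \<kappa> :: real
  defines "S \<equiv> \<lambda>s. 2 * pi * p * s" and "T \<equiv> \<lambda>t. 2 * pi * q * t"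
  defines "P \<equiv> 2 * pi * real p" and "Q \<equiv> 2 * pi * real q"
  defines "u \<equiv> \<lambda>s. 1 - cos (S s)"
  shows "torus_derivs (pinched_torus p q \<kappa>)
    (\<lambda>s t. vector [P * cos (S s) - P * sin (S s) * sin (T t), - sqrt 2 * P * sin (S s) * cos (T t),
       - P * cos (S s) - P * sin (S s) * sin (T t)])
    (\<lambda>s t. vector [- u s * Q * cos (T t), sqrt 2 * u s * Q * sin (T t), - u s * Q * cos (T t)])
    (\<lambda>s t. vector [- P * sin (S s) * Q * cos (T t), sqrt 2 * P * sin (S s) * Q * sin (T t),
       - P * sin (S s) * Q * cos (T t)])"
  unfolding torus_derivs_def pinched_torus_def Let_def S_def T_def P_def Q_def u_def
  apply (intro conjI allI)
  apply ((rule has_vector_derivative_vector3; (rule derivative_eq_intros refl | simp add: algebra_simps)+)+)[4]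
  apply (simp only: sin_cos_nat_periodic)
  apply (simp only: sin_cos_nat_periodic)
  apply (intro continuous_intros)+
  done

text \<open>Sines and cosines are replaced by points on the unit circle, which leaves a polynomial identity.
The angle \<open>T\<close> only survives in terms with a factor \<open>\<kappa>\<close>, so that the limit \<open>\<kappa> = 0\<close> depends on \<open>s\<close>
alone.\<close>

lemma solid_form_pinched_torus:
  fixes P Q C Sn Ct St \<kappa> :: real
  assumes 1: "Sn\<^sup>2 + C\<^sup>2 = 1" and 2: "St\<^sup>2 + Ct\<^sup>2 = 1"
  defines "u \<equiv> 1 - C"
  shows "solid_form (vector [Sn - u * St, - sqrt 2 * (u * Ct + \<kappa>), - Sn - u * St])
    (vector [P * C - P * Sn * St, - sqrt 2 * P * Sn * Ct, - P * C - P * Sn * St])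
    (vector [- u * Q * Ct, sqrt 2 * u * Q * St, - u * Q * Ct])
    = P * Q * (u\<^sup>2 - \<kappa> * u * C * Ct) / sqrt (2 * u + 2 * \<kappa> * u * Ct + \<kappa>\<^sup>2) ^ 3"
proof -
  let ?G = "vector [Sn - u * St, - sqrt 2 * (u * Ct + \<kappa>), - Sn - u * St] :: real^3"
  have s2: "sqrt 2 * sqrt 2 = 2" by simp
  have Sn: "Sn\<^sup>2 = 1 - C\<^sup>2" and St: "St\<^sup>2 = 1 - Ct\<^sup>2" using 1 2 by auto
  have "?G \<bullet> ?G = 2 * (Sn\<^sup>2 + u\<^sup>2 * St\<^sup>2 + (u * Ct + \<kappa>)\<^sup>2)"
    by (simp add: inner_vec_def sum_3 power2_eq_square algebra_simps)
  also have "\<dots> = 2 * (2 * u + 2 * \<kappa> * u * Ct + \<kappa>\<^sup>2)"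
    unfolding Sn St u_def by (simp add: power2_eq_square algebra_simps)
  finally have n: "norm ?G = sqrt 2 * sqrt (2 * u + 2 * \<kappa> * u * Ct + \<kappa>\<^sup>2)"
    by (simp only: norm_eq_sqrt_inner real_sqrt_mult)
  have "triple ?G (vector [P * C - P * Sn * St, - sqrt 2 * P * Sn * Ct, - P * C - P * Sn * St])
    (vector [- u * Q * Ct, sqrt 2 * u * Q * St, - u * Q * Ct])
    = 2 * sqrt 2 * P * Q * u * (Sn\<^sup>2 * (St\<^sup>2 + Ct\<^sup>2) - u * C * (St\<^sup>2 + Ct\<^sup>2) - \<kappa> * C * Ct)"
    unfolding triple_explicit vector_3
    by (simp add: power2_eq_square algebra_simps)
  also have "\<dots> = 2 * sqrt 2 * (P * Q * (u\<^sup>2 - \<kappa> * u * C * Ct))"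
    unfolding 2 Sn u_def by (simp add: power2_eq_square algebra_simps)
  finally show ?thesis
    unfolding solid_form_def n power_mult_distrib by (simp add: power3_eq_cube mult.assoc)
qed

lemma integral_abs_sin:
  assumes "p > 0"
  shows "integral {0..1} (\<lambda>s. \<bar>sin (pi * real p * s)\<bar>) = 2 / pi"
proof -
  let ?f = "\<lambda>s. \<bar>sin (pi * real p * s)\<bar>"
  have per: "?f (s + 1 / real p) = ?f s" for s
    using assms by (simp add: distrib_left)
  have "integral {0..real p * (1 / real p)} ?f = real p * integral {0..1 / real p} ?f"
    using assms by (intro integral_subdivide_periodic per continuous_intros) auto
  also have "integral {0..1 / real p} ?f = integral {0..1 / real p} (\<lambda>s. sin (pi * real p * s))"
  proof (rule Henstock_Kurzweil_Integration.integral_cong)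
    fix s assume "s \<in> {0..1 / real p}"
    then have "0 \<le> pi * real p * s" "pi * real p * s \<le> pi * 1"
      using assms by (auto simp: mult.assoc field_simps intro!: mult_left_mono)
    then show "?f s = sin (pi * real p * s)" by (simp add: sin_ge_zero)
  qed
  also have "\<dots> = 2 / (pi * real p)"
  proof -
    let ?F = "\<lambda>s. - cos (pi * real p * s) / (pi * real p)"
    have "((\<lambda>s. sin (pi * real p * s)) has_integral ?F (1 / real p) - ?F 0) {0..1 / real p}"
      using assms
      by (intro fundamental_theorem_of_calculus)
         (auto intro!: derivative_eq_intros simp: has_real_derivative_iff_has_vector_derivative[symmetric])
    then show ?thesis using assms by (simp add: integral_unique add_divide_distrib[symmetric])
  qed
  finally show ?thesis using assms by simp
qed

text \<open>The bound that allows passing to the limit \<open>\<kappa> \<longrightarrow> 0\<close> under the integral; \<open>w\<close> stands for the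
square root in the denominator of the integrand.\<close>

lemma pinched_numerator_bound:
  fixes u w k c :: real
  assumes u: "0 \<le> u" "u \<le> 2" "u \<le> w\<^sup>2" and k: "0 \<le> k" "k \<le> w" and w: "0 < w" and c: "\<bar>c\<bar> \<le> 1"
  shows "\<bar>u\<^sup>2 - k * u * c\<bar> \<le> 3 * w ^ 3"
proof -
  have u2w: "u \<le> 2 * w"
  proof (cases "w \<le> 1")
    case True
    then have "w\<^sup>2 \<le> w" using w by (simp add: power2_eq_square mult_left_le)
    then show ?thesis using u w by linarith
  qed (use u in linarith)
  have "u * u \<le> (2 * w) * w\<^sup>2" using u w u2w by (intro mult_mono) auto
  moreover have "k * u \<le> w * w\<^sup>2" using u k w by (intro mult_mono) auto
  moreover have "\<bar>k * u * c\<bar> \<le> (k * u) * 1"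
    unfolding abs_mult using u k c by (intro mult_mono) auto
  moreover have "\<bar>u\<^sup>2 - k * u * c\<bar> \<le> u * u + \<bar>k * u * c\<bar>"
    using abs_triangle_ineq4[of "u\<^sup>2" "k * u * c"] by (simp add: power2_eq_square)
  moreover have "w * w\<^sup>2 = w ^ 3" by (simp add: power2_eq_square power3_eq_cube)
  ultimately show ?thesis by linarith
qed

text \<open>As \<open>\<kappa>\<close> tends to \<open>0\<close> the integrand stays bounded and converges to
\<open>2 \<pi>\<^sup>2 p q \<bar>sin (\<pi> p s)\<bar>\<close>, since \<open>u = 2 (sin (S / 2))\<^sup>2\<close>.\<close>

lemma solid_angle_pinched_torus_limit:
  assumes p: "p > 0"
  shows "(\<lambda>n. solid_angle (pinched_torus p q (1 / (real n + 2)))) \<longlonglongrightarrow> 4 * pi * real (p * q)"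
proof -
  define P Q where "P = 2 * pi * real p" and "Q = 2 * pi * real q"
  define u where "u s = 1 - cos (P * s)" for s
  \<comment> \<open>The estimates below need \<open>\<kappa> \<le> 1/2\<close>.\<close>
  define \<kappa> where "\<kappa> n = 1 / (real n + 2)" for n
  define E where "E k s t = 2 * u s + 2 * k * u s * cos (Q * t) + k\<^sup>2" for k s t
  define f where "f k = (\<lambda>(s, t). P * Q * ((u s)\<^sup>2 - k * u s * cos (P * s) * cos (Q * t)) / sqrt (E k s t) ^ 3)" for k
  let ?B = "cbox (0::real,0::real) (1,1)"
  have PQ: "P \<ge> 0" "Q \<ge> 0" by (auto simp: P_def Q_def)
  have u: "0 \<le> u s" "u s \<le> 2" "u s = 2 * (sin (pi * real p * s))\<^sup>2" for s
  proof -
    show "0 \<le> u s" "u s \<le> 2"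
      using cos_ge_minus_one[of "P * s"] cos_le_one[of "P * s"] unfolding u_def by linarith+
    have "P * s = 2 * (pi * real p * s)" by (simp add: P_def)
    then show "u s = 2 * (sin (pi * real p * s))\<^sup>2"
      unfolding u_def by (simp only: cos_double_sin)
  qed
  have k: "0 < \<kappa> n" "\<kappa> n \<le> 1 / 2" for n by (auto simp: \<kappa>_def divide_simps)
  have klim: "\<kappa> \<longlonglongrightarrow> 0"
    using LIMSEQ_Suc[OF LIMSEQ_inverse_real_of_nat]
    by (simp add: \<kappa>_def[abs_def] inverse_eq_divide add.commute)
  have E: "u s + k\<^sup>2 \<le> E k s t" if "0 < k" "k \<le> 1 / 2" for k s t
  proof -
    have "- (1 / 2) \<le> k * cos (Q * t)"
      using that mult_left_mono[OF cos_ge_minus_one[of "Q * t"], of k] by simp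
    then have "u s * (- (1 / 2)) \<le> u s * (k * cos (Q * t))" using u(1) by (intro mult_left_mono)
    then show ?thesis by (simp add: E_def algebra_simps)
  qed
  have Epos: "E k s t > 0" if "0 < k" "k \<le> 1 / 2" for k s t
    using E[OF that, of s t] u(1)[of s] zero_less_power[OF that(1), of 2] by linarith
  have sa: "solid_angle (pinched_torus p q k) = integral ?B (f k)" for k
    unfolding solid_angle_derivs[OF torus_derivs_pinched_torus]
    unfolding pinched_torus_def Let_def f_def E_def u_def P_def Q_def
    by (subst solid_form_pinched_torus) (simp_all add: sin_squared_eq)
  have int: "f (\<kappa> n) integrable_on ?B" for n
  proof -
    have c: "continuous_on ?B (\<lambda>z. E (\<kappa> n) (fst z) (snd z))" "continuous_on ?B (\<lambda>z. u (fst z))"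
      unfolding E_def u_def by (intro continuous_intros)+
    show ?thesis
      unfolding f_def split_beta
      by (intro integrable_continuous continuous_intros c) (use Epos[OF k] in \<open>simp add: less_imp_neq[symmetric]\<close>)
  qed
  have bound: "norm (f k z) \<le> P * Q * 3" if kk: "0 < k" "k \<le> 1 / 2" for k z
  proof -
    obtain s t where z: "z = (s, t)" by (cases z)
    define w where "w = sqrt (E k s t)"
    have w: "w > 0" "w\<^sup>2 = E k s t" using Epos[OF kk, of s t] by (auto simp: w_def)
    have w1: "u s \<le> w\<^sup>2" "k\<^sup>2 \<le> w\<^sup>2"
      using E[OF kk, of s t] u(1)[of s] zero_le_power2[of k] unfolding w(2) by linarith+
    have w2: "k \<le> w" by (rule power2_le_imp_le[OF w1(2)]) (use w in simp)
    have "\<bar>cos (P * s) * cos (Q * t)\<bar> \<le> 1 * 1"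
      unfolding abs_mult by (intro mult_mono) auto
    then have "\<bar>(u s)\<^sup>2 - k * u s * (cos (P * s) * cos (Q * t))\<bar> \<le> 3 * w ^ 3"
      using pinched_numerator_bound[OF u(1,2) w1(1) _ w2 w(1)] kk by simp
    then have "\<bar>(u s)\<^sup>2 - k * u s * cos (P * s) * cos (Q * t)\<bar> / w ^ 3 \<le> 3"
      using w(1) by (simp only: pos_divide_le_eq[OF zero_less_power[OF w(1)]] mult.assoc)
    then have "P * Q * (\<bar>(u s)\<^sup>2 - k * u s * cos (P * s) * cos (Q * t)\<bar> / w ^ 3) \<le> P * Q * 3"
      using PQ by (intro mult_left_mono) auto
    moreover have "norm (f k z) = P * Q * (\<bar>(u s)\<^sup>2 - k * u s * cos (P * s) * cos (Q * t)\<bar> / w ^ 3)"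
      unfolding z f_def prod.case w_def[symmetric] real_norm_def abs_divide abs_mult[of "P * Q"]
      using PQ w(1) by simp
    ultimately show ?thesis by simp
  qed
  have lim: "(\<lambda>n. f (\<kappa> n) z) \<longlonglongrightarrow> P * Q * \<bar>sin (pi * real p * fst z)\<bar> / 2" for z
  proof -
    obtain s t where z: "z = (s, t)" by (cases z)
    let ?x = "\<bar>sin (pi * real p * s)\<bar>"
    have ux: "u s = 2 * ?x\<^sup>2" using u(3) by simp
    show ?thesis
    proof (cases "?x = 0")
      case True
      then have "u s = 0" using ux by simp
      with True show ?thesis by (simp add: z f_def)
    next
      case False
      then have x: "?x > 0" by simp
      have sq: "sqrt (2 * u s) = 2 * ?x"
        unfolding ux by (rule real_sqrt_unique) (simp_all add: power_mult_distrib)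
      define R where "R = P * Q * ((u s)\<^sup>2 - 0 * u s * cos (P * s) * cos (Q * t)) /
        sqrt (2 * u s + 2 * 0 * u s * cos (Q * t) + 0\<^sup>2) ^ 3"
      have "(\<lambda>n. f (\<kappa> n) z) \<longlonglongrightarrow> R"
        unfolding f_def z prod.case E_def R_def
        by (intro tendsto_intros klim) (use sq x in auto)
      moreover have "R = P * Q * ?x / 2"
      proof -
        have "R = P * Q * (2 * ?x\<^sup>2)\<^sup>2 / (2 * ?x) ^ 3"
          unfolding R_def by (simp add: sq) (simp add: ux)
        also have "\<dots> = P * Q * ?x / 2"
          using x by (simp add: field_simps eval_nat_numeral)
        finally show ?thesis .
      qed
      ultimately show ?thesis by (simp add: z)
    qed
  qed
  have "(\<lambda>n. integral ?B (f (\<kappa> n))) \<longlonglongrightarrow> integral ?B (\<lambda>z. P * Q * \<bar>sin (pi * real p * fst z)\<bar> / 2)"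
    by (rule dominated_convergence[OF int _ bound[OF k] lim]) (rule integrable_const)
  moreover have "integral ?B (\<lambda>z. P * Q * \<bar>sin (pi * real p * fst z)\<bar> / 2) = 4 * pi * real (p * q)"
  proof -
    have "integral ?B (\<lambda>z. P * Q * \<bar>sin (pi * real p * fst z)\<bar> / 2)
        = P * Q / 2 * integral {0..1} (\<lambda>s. \<bar>sin (pi * real p * s)\<bar>)"
      by (subst integral_prod_continuous) (auto intro!: continuous_intros)
    then show ?thesis by (simp add: integral_abs_sin[OF p] P_def Q_def)
  qed
  ultimately show ?thesis by (simp only: sa \<kappa>_def)
qed

section \<open>Stereographic projection\<close>

lemma det_4:
  "det (A::'a::comm_ring_1^4^4) =
    A$1$1 * det (vector [vector [A$2$2, A$2$3, A$2$4], vector [A$3$2, A$3$3, A$3$4], vector [A$4$2, A$4$3, A$4$4]] :: 'a^3^3)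
  - A$1$2 * det (vector [vector [A$2$1, A$2$3, A$2$4], vector [A$3$1, A$3$3, A$3$4], vector [A$4$1, A$4$3, A$4$4]] :: 'a^3^3)
  + A$1$3 * det (vector [vector [A$2$1, A$2$2, A$2$4], vector [A$3$1, A$3$2, A$3$4], vector [A$4$1, A$4$2, A$4$4]] :: 'a^3^3)
  - A$1$4 * det (vector [vector [A$2$1, A$2$2, A$2$3], vector [A$3$1, A$3$2, A$3$3], vector [A$4$1, A$4$2, A$4$3]] :: 'a^3^3)"
proof -
  have f: "finite {2::4, 3, 4}" "1 \<notin> {2::4, 3, 4}" "finite {3::4, 4}" "2 \<notin> {3::4, 4}"
    "finite {4::4}" "3 \<notin> {4::4}"
    by auto
  show ?thesis
    unfolding det_3 vector_3
    unfolding det_def UNIV_4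
    unfolding sum_over_permutations_insert[OF f(1,2)]
    unfolding sum_over_permutations_insert[OF f(3,4)]
    unfolding sum_over_permutations_insert[OF f(5,6)]
    unfolding permutes_sing
    by (simp add: sign_swap_id permutation_swap_id permutation_compose sign_compose sign_id swap_id_eq algebra_simps)
qed

lemma vector_4:
 "(vector [x,y,z,w] ::('a::zero)^4)$1 = x"
 "(vector [x,y,z,w] ::('a::zero)^4)$2 = y"
 "(vector [x,y,z,w] ::('a::zero)^4)$3 = z"
 "(vector [x,y,z,w] ::('a::zero)^4)$4 = w"
  unfolding vector_def by simp_all

text \<open>The coordinates of \<open>w\<close> with respect to \<open>\<i> N, \<j> N, \<k> N\<close>, where \<open>\<complex>\<^sup>2\<close> is regarded as the quaternions.
For a unit vector \<open>N\<close> this is an orthonormal basis of the space orthogonal to \<open>N\<close>. It depends continuously on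
\<open>N\<close>, so that projections from different poles become maps into the same space.\<close>

definition frame :: "C2 \<Rightarrow> C2 \<Rightarrow> real^3" where
  "frame N w = vector [w \<bullet> (\<i> * fst N, \<i> * snd N), w \<bullet> (- cnj (snd N), cnj (fst N)),
     w \<bullet> (- \<i> * cnj (snd N), \<i> * cnj (fst N))]"

text \<open>The basis \<open>N, \<i> N, \<j> N, \<k> N\<close> is orthogonal and positively oriented, and its vectors have the length
of \<open>N\<close>.\<close>

lemma det4_frame:
  "triple (frame N u) (frame N v) (frame N w) = (N \<bullet> N) * det4 N u v w"
proof -
  obtain a b c d where N: "N = (Complex a b, Complex c d)" by (metis complex.exhaust prod.exhaust)
  obtain a1 b1 c1 d1 where u: "u = (Complex a1 b1, Complex c1 d1)" by (metis complex.exhaust prod.exhaust)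
  obtain a2 b2 c2 d2 where v: "v = (Complex a2 b2, Complex c2 d2)" by (metis complex.exhaust prod.exhaust)
  obtain a3 b3 c3 d3 where w: "w = (Complex a3 b3, Complex c3 d3)" by (metis complex.exhaust prod.exhaust)
  show ?thesis
    unfolding det4_def coords_def det_4 det_3 vector_3 vector_4 triple_explicit frame_def N u v w
    by (simp add: inner_prod_def inner_complex_def) algebra
qed

lemma norm_frame:
  assumes "norm N = 1" "w \<bullet> N = 0"
  shows "norm (frame N w) = norm w"
proof -
  obtain a b c d where N: "N = (Complex a b, Complex c d)" by (metis complex.exhaust prod.exhaust)
  obtain a1 b1 c1 d1 where u: "w = (Complex a1 b1, Complex c1 d1)" by (metis complex.exhaust prod.exhaust)
  have "(N \<bullet> N) * (w \<bullet> w) = (w \<bullet> N)\<^sup>2 + frame N w \<bullet> frame N w"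
    unfolding N u frame_def
    by (simp add: inner_prod_def inner_complex_def inner_vec_def sum_3) algebra
  then show ?thesis using assms by (simp add: norm_eq_sqrt_inner)
qed

lemma bounded_linear_frame: "bounded_linear (frame N)"
  by (intro linear_conv_bounded_linear[THEN iffD1] linearI)
    (simp_all add: frame_def vec_eq_iff forall_3 inner_add_left)

lemma one_minus_inner_pos:
  fixes x N :: "'a::real_inner"
  assumes "norm x = 1" "norm N = 1" "x \<noteq> N"
  shows "1 - x \<bullet> N > 0"
proof -
  have "(x - N) \<bullet> (x - N) > 0" using assms by (simp add: inner_gt_zero_iff)
  moreover have "(x - N) \<bullet> (x - N) = 2 * (1 - x \<bullet> N)"
    using assms by (simp add: inner_diff_left inner_diff_right inner_commute norm_eq_1)
  ultimately show ?thesis by simp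
qed

lemma stereo_orthogonal: "norm N = 1 \<Longrightarrow> stereo N x \<bullet> N = 0"
  by (simp add: stereo_def inner_diff_left norm_eq_1)

text \<open>The norm of the projection of \<open>x\<close> determines the height \<open>x \<bullet> N\<close>, and the height and the
projection determine \<open>x\<close>.\<close>

lemma stereo_inj:
  assumes N: "norm N = 1" and x: "norm x = 1" "x \<noteq> N" and y: "norm y = 1" "y \<noteq> N"
    and eq: "stereo N x = stereo N y"
  shows "x = y"
proof -
  have sq: "stereo N z \<bullet> stereo N z * (1 - z \<bullet> N) = 1 + z \<bullet> N" if "norm z = 1" "z \<noteq> N" for z
  proof -
    have p: "1 - z \<bullet> N > 0" using one_minus_inner_pos that N by blast
    have "stereo N z \<bullet> stereo N z = (1 - (z \<bullet> N)\<^sup>2) / (1 - z \<bullet> N)\<^sup>2"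
      using N that by (simp add: stereo_def inner_diff_left inner_diff_right norm_eq_1 inner_commute power2_eq_square)
    also have "\<dots> = ((1 + z \<bullet> N) * (1 - z \<bullet> N)) / (1 - z \<bullet> N)\<^sup>2"
      by (simp add: power2_eq_square algebra_simps)
    finally show ?thesis using p by (simp add: power2_eq_square)
  qed
  define S where "S = stereo N x \<bullet> stereo N x"
  have "S * (1 - x \<bullet> N) = 1 + x \<bullet> N" "S * (1 - y \<bullet> N) = 1 + y \<bullet> N" "S \<ge> 0"
    using sq[OF x] sq[OF y] eq by (simp_all add: S_def)
  then have "(S + 1) * (x \<bullet> N) = (S + 1) * (y \<bullet> N)" "S + 1 > 0"
    by (simp_all add: algebra_simps)
  then have h: "x \<bullet> N = y \<bullet> N" by simp
  have "x - (x \<bullet> N) *\<^sub>R N = y - (y \<bullet> N) *\<^sub>R N"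
    using eq one_minus_inner_pos[OF y(1) N y(2)] unfolding stereo_def h by simp
  then show ?thesis using h by simp
qed

definition stereo_deriv :: "C2 \<Rightarrow> C2 \<Rightarrow> C2 \<Rightarrow> C2" where
  "stereo_deriv N x v = ((v \<bullet> N) / (1 - x \<bullet> N)\<^sup>2) *\<^sub>R (x - (x \<bullet> N) *\<^sub>R N)
     + (1 / (1 - x \<bullet> N)) *\<^sub>R (v - (v \<bullet> N) *\<^sub>R N)"

lemma has_vector_derivative_stereo:
  assumes x: "(x has_vector_derivative x') (at s)" and nz: "1 - x s \<bullet> N \<noteq> 0"
  shows "((\<lambda>s. stereo N (x s)) has_vector_derivative stereo_deriv N (x s) x') (at s)"
proof -
  have d: "((\<lambda>s. x s \<bullet> N) has_real_derivative x' \<bullet> N) (at s)"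
    using bounded_linear.has_vector_derivative[OF bounded_linear_inner_left x, of N]
    by (simp add: has_real_derivative_iff_has_vector_derivative)
  have d1: "((\<lambda>s. 1 / (1 - x s \<bullet> N)) has_real_derivative (x' \<bullet> N) / (1 - x s \<bullet> N)\<^sup>2) (at s)"
    using nz by (auto intro!: derivative_eq_intros d simp: power2_eq_square)
  have d2: "((\<lambda>s. x s - (x s \<bullet> N) *\<^sub>R N) has_vector_derivative x' - (x' \<bullet> N) *\<^sub>R N) (at s)"
    using d by (auto intro!: derivative_eq_intros x simp: has_real_derivative_iff_has_vector_derivative)
  show ?thesis
    using has_vector_derivative_scaleR[OF d1 d2] unfolding stereo_def stereo_deriv_def by (simp add: add.commute)
qed

definition link_map :: "C2 \<Rightarrow> (real \<Rightarrow> C2) \<Rightarrow> (real \<Rightarrow> C2) \<Rightarrow> real \<Rightarrow> real \<Rightarrow> real^3" where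
  "link_map N x y s t = frame N (stereo N (x s) - stereo N (y t))"

definition smooth_loop :: "(real \<Rightarrow> C2) \<Rightarrow> (real \<Rightarrow> C2) \<Rightarrow> bool" where
  "smooth_loop x x' \<longleftrightarrow> (\<forall>s. (x has_vector_derivative x' s) (at s) \<and> x s \<in> S3 \<and> x (s + 1) = x s)
     \<and> continuous_on UNIV x'"

lemma torus_derivs_link_map:
  assumes N: "N \<in> S3" and x: "smooth_loop x x'" "\<And>s. x s \<noteq> N" and y: "smooth_loop y y'" "\<And>s. y s \<noteq> N"
  shows "torus_derivs (link_map N x y) (\<lambda>s t. frame N (stereo_deriv N (x s) (x' s)))
     (\<lambda>s t. - frame N (stereo_deriv N (y t) (y' t))) (\<lambda>s t. 0)"
proof -
  note frame_deriv = bounded_linear.has_vector_derivative[OF bounded_linear_frame]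
  note frame_cont = bounded_linear.continuous_on[OF bounded_linear_frame]
  have nz: "1 - x s \<bullet> N \<noteq> 0" "1 - y s \<bullet> N \<noteq> 0" for s
    using one_minus_inner_pos[of "x s" N] one_minus_inner_pos[of "y s" N] assms
    by (auto simp: smooth_loop_def less_imp_neq)
  have dx: "((\<lambda>s. stereo N (x s)) has_vector_derivative stereo_deriv N (x s) (x' s)) (at s)"
    "((\<lambda>s. stereo N (y s)) has_vector_derivative stereo_deriv N (y s) (y' s)) (at s)" for s
    using x y nz by (auto intro!: has_vector_derivative_stereo simp: smooth_loop_def)
  have cx: "continuous_on UNIV x" "continuous_on UNIV x'" "continuous_on UNIV y" "continuous_on UNIV y'"
    using x y unfolding smooth_loop_def
    by (metis continuous_at_imp_continuous_on has_vector_derivative_continuous)+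
  have c: "continuous_on UNIV (\<lambda>z. F (fst z))" "continuous_on UNIV (\<lambda>z. F (snd z))"
    if "continuous_on UNIV F" for F :: "real \<Rightarrow> C2"
    using continuous_on_compose2[OF that continuous_on_fst[OF continuous_on_id]]
      continuous_on_compose2[OF that continuous_on_snd[OF continuous_on_id]] by auto
  have 1: "((\<lambda>s. link_map N x y s t) has_vector_derivative frame N (stereo_deriv N (x s) (x' s))) (at s)" for s t
    unfolding link_map_def
    by (rule frame_deriv) (auto intro!: derivative_eq_intros dx)
  have 2: "(link_map N x y s has_vector_derivative - frame N (stereo_deriv N (y t) (y' t))) (at t)" for s t
  proof -
    have "(link_map N x y s has_vector_derivative frame N (- stereo_deriv N (y t) (y' t))) (at t)"
      unfolding link_map_def
      by (rule frame_deriv) (auto intro!: derivative_eq_intros dx)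
    then show ?thesis
      by (simp add: linear_neg[OF bounded_linear.linear[OF bounded_linear_frame]])
  qed
  show ?thesis
    unfolding torus_derivs_def
  proof (intro conjI allI 1 2)
    show "continuous_on UNIV (\<lambda>z. link_map N x y (fst z) (snd z))"
      unfolding link_map_def stereo_def
      by (intro continuous_intros frame_cont c cx) (use nz in auto)
    show "continuous_on UNIV (\<lambda>z. frame N (stereo_deriv N (x (fst z)) (x' (fst z))))"
      unfolding stereo_deriv_def
      by (intro continuous_intros frame_cont c cx) (use nz in auto)
    show "continuous_on UNIV (\<lambda>z. - frame N (stereo_deriv N (y (snd z)) (y' (snd z))))"
      unfolding stereo_deriv_def
      by (intro continuous_intros frame_cont c cx) (use nz in auto)
  qed (use x y in \<open>auto simp: smooth_loop_def link_map_def\<close>)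
qed

lemma link_map_nonzero:
  assumes "N \<in> S3" "x s \<in> S3" "y t \<in> S3" "x s \<noteq> N" "y t \<noteq> N" "x s \<noteq> y t"
  shows "link_map N x y s t \<noteq> 0"
proof -
  have "norm (link_map N x y s t) = norm (stereo N (x s) - stereo N (y t))"
    unfolding link_map_def using assms by (intro norm_frame) (auto simp: inner_diff_left stereo_orthogonal)
  moreover have "stereo N (x s) \<noteq> stereo N (y t)"
    using stereo_inj[of N "x s" "y t"] assms by auto
  ultimately show ?thesis by auto
qed

section \<open>Tori of pairs of fibers\<close>

text \<open>A triple \<open>(\<theta>, u, v)\<close> with \<open>0 \<le> \<theta> \<le> \<pi>/2\<close> stands for the point
\<open>(cos \<theta> cis u, sin \<theta> cis v)\<close> of \<open>S\<^sup>3\<close>.\<close>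

type_synonym angles = "real \<times> real \<times> real"

text \<open>The orbit of the circle action through the point with angles \<open>A\<close>, over one period of the action. The
exceptional fibers \<open>\<theta> = 0\<close> and \<open>\<theta> = \<pi>/2\<close> are run through \<open>p\<close> and \<open>q\<close> times.\<close>

definition knot_curve :: "nat \<Rightarrow> nat \<Rightarrow> angles \<Rightarrow> real \<Rightarrow> C2" where
  "knot_curve p q A s = (of_real (cos (fst A)) * cis (fst (snd A) + 2 * pi * real p * s),
     of_real (sin (fst A)) * cis (snd (snd A) + 2 * pi * real q * s))"

lemma knot_curve_S3: "knot_curve p q A s \<in> S3"
  by (simp add: knot_curve_def norm_prod_def norm_mult)

lemma cis_nat_periodic: "cis (a + 2 * pi * real n * (s + 1)) = cis (a + 2 * pi * real n * s)"
proof -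
  have "a + 2 * pi * real n * (s + 1) = (a + 2 * pi * real n * s) + 2 * pi * real n"
    by (simp add: algebra_simps)
  then show ?thesis by (simp only: cis_mult[symmetric]) simp
qed

lemma smooth_loop_knot_curve: "\<exists>x'. smooth_loop (knot_curve p q A) x'"
proof -
  let ?x' = "\<lambda>s. (of_real (cos (fst A)) * ((2 * pi * real p) *\<^sub>R (\<i> * cis (fst (snd A) + 2 * pi * real p * s))),
     of_real (sin (fst A)) * ((2 * pi * real q) *\<^sub>R (\<i> * cis (snd (snd A) + 2 * pi * real q * s))))"
  have "(knot_curve p q A has_vector_derivative ?x' s) (at s)" for s
    unfolding knot_curve_def has_vector_derivative_def
    by (auto intro!: derivative_eq_intros simp: scaleR_conv_of_real algebra_simps)
  moreover have "continuous_on UNIV ?x'"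
    by (intro continuous_intros)
  moreover have "knot_curve p q A (s + 1) = knot_curve p q A s" for s
    unfolding knot_curve_def cis_nat_periodic ..
  ultimately show ?thesis
    unfolding smooth_loop_def using knot_curve_S3 by (intro exI[of _ ?x']) blast
qed

lemma continuous_on_knot_curve [continuous_intros]:
  fixes S :: "'a::t2_space set"
  assumes "continuous_on S A" "continuous_on S f"
  shows "continuous_on S (\<lambda>z. knot_curve p q (A z) (f z))"
  unfolding knot_curve_def by (intro continuous_intros assms)

lemma continuous_on_frame [continuous_intros]:
  assumes "continuous_on S N" "continuous_on S w"
  shows "continuous_on S (\<lambda>z. frame (N z) (w z))"
  unfolding frame_def by (intro continuous_intros assms)

text \<open>Distinctness of the fibers, expressed in angles: \<open>\<theta>\<close> and \<open>q u - p v\<close> modulo \<open>2 \<pi>\<close> are constant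
along a fiber, and the latter has no meaning on the exceptional fibers.\<close>

definition separated :: "nat \<Rightarrow> nat \<Rightarrow> angles \<Rightarrow> angles \<Rightarrow> bool" where
  "separated p q A B \<longleftrightarrow> fst A \<noteq> fst B \<or>
     (0 < fst A \<and> fst A < pi / 2 \<and>
       (real q * (fst (snd A) - fst (snd B)) - real p * (snd (snd A) - snd (snd B))) / (2 * pi) \<notin> \<int>)"

lemma cis_eq_iff: "cis a = cis b \<longleftrightarrow> (a - b) / (2 * pi) \<in> \<int>"
proof
  assume "cis a = cis b"
  then have "sin a = sin b \<and> cos a = cos b" by (auto simp: complex_eq_iff)
  then obtain n :: int where "a = b + 2 * pi * n" by (auto simp: sin_cos_eq_iff)
  then show "(a - b) / (2 * pi) \<in> \<int>" by simp
next
  assume "(a - b) / (2 * pi) \<in> \<int>"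
  then obtain n where "(a - b) / (2 * pi) = of_int n" by (auto elim: Ints_cases)
  then have "a = b + 2 * pi * of_int n" by (simp add: field_simps)
  then show "cis a = cis b" by (simp only: cis_mult[symmetric]) simp
qed

lemma separated_disjoint:
  assumes A: "fst A \<in> {0..pi/2}" and B: "fst B \<in> {0..pi/2}" and sep: "separated p q A B"
  shows "knot_curve p q A s \<noteq> knot_curve p q B t"
proof
  assume eq: "knot_curve p q A s = knot_curve p q B t"
  from arg_cong[OF eq, of "\<lambda>z. norm (fst z)"]
  have "\<bar>cos (fst A)\<bar> = \<bar>cos (fst B)\<bar>" by (simp add: knot_curve_def norm_mult)
  moreover have "cos (fst A) \<ge> 0" "cos (fst B) \<ge> 0" using A B by (auto intro: cos_ge_zero)
  ultimately have "cos (fst A) = cos (fst B)" by simp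
  then have th: "fst A = fst B" using A B by (intro cos_inj_pi[of "fst A" "fst B"]) auto
  with sep have A': "0 < fst A" "fst A < pi / 2" and
    D: "(real q * (fst (snd A) - fst (snd B)) - real p * (snd (snd A) - snd (snd B))) / (2 * pi) \<notin> \<int>"
    by (auto simp: separated_def)
  have "cos (fst A) > 0" "sin (fst A) > 0" using A' by (auto intro: cos_gt_zero sin_gt_zero)
  then have "cis (fst (snd A) + 2 * pi * real p * s) = cis (fst (snd B) + 2 * pi * real p * t)"
    "cis (snd (snd A) + 2 * pi * real q * s) = cis (snd (snd B) + 2 * pi * real q * t)"
    using arg_cong[OF eq, of fst] arg_cong[OF eq, of snd] th by (simp_all add: knot_curve_def)
  then have i: "(fst (snd A) + 2 * pi * real p * s - (fst (snd B) + 2 * pi * real p * t)) / (2 * pi) \<in> \<int>"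
    "(snd (snd A) + 2 * pi * real q * s - (snd (snd B) + 2 * pi * real q * t)) / (2 * pi) \<in> \<int>"
    by (simp_all only: cis_eq_iff)
  have e: "(a + 2 * pi * n * s - (b + 2 * pi * n * t)) / (2 * pi) = (a - b) / (2 * pi) + n * (s - t)" for a b n :: real
  proof -
    have "a + 2 * pi * n * s - (b + 2 * pi * n * t) = (a - b) + (2 * pi) * (n * (s - t))"
      by (simp add: algebra_simps)
    then show ?thesis by (simp only: add_divide_distrib) simp
  qed
  have comb: "m * (x / (2 * pi) + n * d) - n * (y / (2 * pi) + m * d) = (m * x - n * y) / (2 * pi)" for m n x y d :: real
    by (simp add: algebra_simps diff_divide_distrib)
  have "real q * ((fst (snd A) - fst (snd B)) / (2 * pi) + real p * (s - t))
     - real p * ((snd (snd A) - snd (snd B)) / (2 * pi) + real q * (s - t)) \<in> \<int>"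
    using Ints_diff[OF Ints_mult[OF Ints_of_nat[of q] i(1)] Ints_mult[OF Ints_of_nat[of p] i(2)]]
    unfolding e .
  also have "real q * ((fst (snd A) - fst (snd B)) / (2 * pi) + real p * (s - t))
     - real p * ((snd (snd A) - snd (snd B)) / (2 * pi) + real q * (s - t))
     = (real q * (fst (snd A) - fst (snd B)) - real p * (snd (snd A) - snd (snd B))) / (2 * pi)"
    by (rule comb)
  finally show False using D by simp
qed

text \<open>On a regular fiber, matching both phases modulo \<open>2 \<pi>\<close> amounts to solving two congruences for \<open>s\<close> at
once; as \<open>p\<close> and \<open>q\<close> are coprime, Bezout's identity provides the solution whenever \<open>q u - p v\<close>
agrees.\<close>

lemma disjoint_separated:
  assumes pq: "p > 0" "q > 0" "coprime p q" and A: "fst A \<in> {0..pi/2}"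
    and dis: "\<And>s. knot_curve p q A s \<noteq> knot_curve p q B 0"
  shows "separated p q A B"
proof (rule ccontr)
  assume ns: "\<not> separated p q A B"
  obtain \<theta> u v where Aeq: "A = (\<theta>, u, v)" by (metis prod.exhaust)
  obtain u' v' where Beq: "B = (\<theta>, u', v')" using ns by (cases B) (auto simp: separated_def Aeq)
  have "\<exists>s. knot_curve p q A s = knot_curve p q B 0"
  proof -
    consider "\<theta> = 0" | "\<theta> = pi / 2" | "0 < \<theta>" "\<theta> < pi / 2" using A Aeq by force
    then show ?thesis
    proof cases
      case 1
      then have "knot_curve p q A ((u' - u) / (2 * pi * real p)) = knot_curve p q B 0"
        using pq by (simp add: knot_curve_def Aeq Beq)
      then show ?thesis ..
    next
      case 2
      then have "knot_curve p q A ((v' - v) / (2 * pi * real q)) = knot_curve p q B 0"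
        using pq unfolding Aeq Beq 2 by (simp add: knot_curve_def)
      then show ?thesis ..
    next
      case 3
      then have "(real q * (u - u') - real p * (v - v')) / (2 * pi) \<in> \<int>"
        using ns by (auto simp: separated_def Aeq Beq)
      then obtain k where k: "(real q * (u - u') - real p * (v - v')) / (2 * pi) = of_int k"
        by (auto elim: Ints_cases)
      obtain a b :: int where ab: "a * int p + b * int q = 1"
        using bezout_int[of "int p" "int q"] pq(3) by auto
      \<comment> \<open>All solutions of the first congruence differ by multiples of \<open>1 / p\<close>; this one also solves the second.\<close>
      define s where "s = (u' - u + 2 * pi * of_int (k * b)) / (2 * pi * real p)"
      have s: "2 * pi * real p * s = u' - u + 2 * pi * of_int (k * b)"
        using pq by (simp add: s_def)
      have "real p * (2 * pi * real q * s) = real q * (2 * pi * real p * s)" by simp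
      also have "\<dots> = real q * (u' - u) + 2 * pi * (of_int k * (of_int b * real q))"
        unfolding s by (simp add: algebra_simps)
      also have "of_int b * real q = 1 - of_int a * real p"
        using arg_cong[OF ab, of real_of_int] by simp
      also have "real q * (u' - u) = - (2 * pi * of_int k) - real p * (v - v')"
        using k by (simp add: field_simps)
      finally have "real p * (2 * pi * real q * s) = real p * (v' - v - 2 * pi * of_int (k * a))"
        by (simp add: algebra_simps)
      then have t: "2 * pi * real q * s = v' - v - 2 * pi * of_int (k * a)" using pq by simp
      have "cis (u + 2 * pi * real p * s) = cis u'" "cis (v + 2 * pi * real q * s) = cis v'"
        unfolding cis_eq_iff s t by simp_all
      then have "knot_curve p q A s = knot_curve p q B 0" by (simp add: knot_curve_def Aeq Beq)
      then show ?thesis ..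
    qed
  qed
  with dis show False by blast
qed

text \<open>The pole of the projection is given by the angles \<open>C\<close>, so that it is treated like a point on a third
fiber.\<close>

definition knot_angle :: "nat \<Rightarrow> nat \<Rightarrow> angles \<Rightarrow> angles \<Rightarrow> angles \<Rightarrow> real" where
  "knot_angle p q A B C = solid_angle (link_map (knot_curve p q C 0) (knot_curve p q A) (knot_curve p q B))"

lemma knot_angle_path:
  fixes A B C A' B' C' :: angles
  assumes valid: "\<And>X. X \<in> {A, B, C, A', B', C'} \<Longrightarrow> fst X \<in> {0..pi/2}"
    and sep: "\<And>r. r \<in> {0..1} \<Longrightarrow> separated p q (A + r *\<^sub>R (A' - A)) (B + r *\<^sub>R (B' - B))
      \<and> separated p q (A + r *\<^sub>R (A' - A)) (C + r *\<^sub>R (C' - C))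
      \<and> separated p q (B + r *\<^sub>R (B' - B)) (C + r *\<^sub>R (C' - C))"
  shows "knot_angle p q A B C = knot_angle p q A' B' C'"
proof -
  define L where "L X Y r = X + r *\<^sub>R (Y - X)" for X Y :: angles and r
  have v: "fst (L X Y r) \<in> {0..pi/2}" if "X \<in> {A, B, C}" "Y \<in> {A', B', C'}" "r \<in> {0..1}" for X Y r
  proof -
    have "fst (L X Y r) = (1 - r) * fst X + r * fst Y" by (simp add: L_def algebra_simps)
    then show ?thesis
      using convexD[OF convex_real_interval(5)[of 0 "pi/2"], of "fst X" "fst Y" "1 - r" r] valid[of X] valid[of Y] that
      by auto
  qed
  define F where "F r = link_map (knot_curve p q (L C C' r) 0) (knot_curve p q (L A A' r)) (knot_curve p q (L B B' r))" for r
  have sepL: "separated p q (L A A' r) (L B B' r)" "separated p q (L A A' r) (L C C' r)"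
    "separated p q (L B B' r) (L C C' r)" if "r \<in> {0..1}" for r
    using sep[OF that] by (auto simp: L_def)
  have ne: "knot_curve p q (L A A' r) s \<noteq> knot_curve p q (L B B' r) t"
    "knot_curve p q (L A A' r) s \<noteq> knot_curve p q (L C C' r) t"
    "knot_curve p q (L B B' r) s \<noteq> knot_curve p q (L C C' r) t" if "r \<in> {0..1}" for r s t
    using separated_disjoint[OF v[OF _ _ that] v[OF _ _ that] sepL(1)[OF that]]
      separated_disjoint[OF v[OF _ _ that] v[OF _ _ that] sepL(2)[OF that]]
      separated_disjoint[OF v[OF _ _ that] v[OF _ _ that] sepL(3)[OF that]] by blast+
  have "solid_angle (F 0) = solid_angle (F 1)"
  proof (rule solid_angle_homotopy)
    show "\<exists>Gs Gt Gst. torus_derivs (F r) Gs Gt Gst" if r: "r \<in> {0..1}" for r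
    proof -
      obtain x' y' where "smooth_loop (knot_curve p q (L A A' r)) x'" "smooth_loop (knot_curve p q (L B B' r)) y'"
        using smooth_loop_knot_curve by blast
      from torus_derivs_link_map[OF knot_curve_S3 this(1) ne(2)[OF r] this(2) ne(3)[OF r]]
      show ?thesis unfolding F_def by blast
    qed
    show "F r s t \<noteq> 0" if "r \<in> {0..1}" for r s t
      unfolding F_def using ne[OF that] knot_curve_S3 by (intro link_map_nonzero) auto
    show "continuous_on ({0..1} \<times> {0..1} \<times> {0..1}) (\<lambda>(r, s, t). F r s t)"
    proof -
      have "1 - knot_curve p q (L A A' r) s \<bullet> knot_curve p q (L C C' r) 0 \<noteq> 0"
        "1 - knot_curve p q (L B B' r) s \<bullet> knot_curve p q (L C C' r) 0 \<noteq> 0" if "r \<in> {0..1}" for r s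
        using one_minus_inner_pos[OF _ _ ne(2)[OF that, of s 0]] one_minus_inner_pos[OF _ _ ne(3)[OF that, of s 0]]
          knot_curve_S3[of p q] by (auto simp: less_imp_neq)
      then show ?thesis
        unfolding F_def link_map_def stereo_def L_def split_beta
        by (intro continuous_intros) auto
    qed
  qed
  then show ?thesis by (simp add: F_def L_def knot_angle_def)
qed

lemma frame_stereo:
  "frame N (stereo N x) = (1 / (1 - x \<bullet> N)) *\<^sub>R frame N x"
proof -
  have 0: "frame N N = 0"
    by (simp add: frame_def vec_eq_iff forall_3 inner_prod_def inner_complex_def)
  have lin: "linear (frame N)" using bounded_linear_frame bounded_linear.linear by blast
  show ?thesis
    unfolding stereo_def linear_scale[OF lin] linear_diff[OF lin] 0 by simp
qed

text \<open>The two exceptional fibers form a Hopf link, here projected from a point halfway between them.\<close>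

lemma hopf_link_map:
  fixes p q :: nat and s t :: real
  defines "S \<equiv> 2 * pi * real p * s" and "T \<equiv> 2 * pi * real q * t"
  shows "link_map (knot_curve p q (pi/4, 0, 0) 0) (knot_curve p q (0, 0, 0)) (knot_curve p q (pi/2, 0, 0)) s t
    = vector [sin S / (sqrt 2 - cos S) - sin T / (sqrt 2 - cos T),
        - cos S / (sqrt 2 - cos S) - cos T / (sqrt 2 - cos T),
        - sin S / (sqrt 2 - cos S) - sin T / (sqrt 2 - cos T)]"
proof -
  let ?c = "1 / sqrt 2 :: real"
  have c: "sqrt 2 / 2 = ?c" by (simp add: divide_simps)
  define N :: C2 where "N = (of_real ?c, of_real ?c)"
  have N: "knot_curve p q (pi/4, 0, 0) 0 = N"
    by (simp add: knot_curve_def N_def cos_45 sin_45 c)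
  have x: "knot_curve p q (0, 0, 0) s = (cis S, 0)" and y: "knot_curve p q (pi/2, 0, 0) t = (0, cis T)"
    by (simp_all add: knot_curve_def S_def T_def)
  have lin: "linear (frame N)" using bounded_linear_frame bounded_linear.linear by blast
  have fx: "frame N (cis S, 0) = ?c *\<^sub>R vector [sin S, - cos S, - sin S]"
    and fy: "frame N (0, cis T) = ?c *\<^sub>R vector [sin T, cos T, sin T]"
    by (simp_all add: frame_def N_def vec_eq_iff forall_3 inner_prod_def inner_complex_def)
  have ix: "(cis S, 0) \<bullet> N = ?c * cos S" and iy: "(0, cis T) \<bullet> N = ?c * cos T"
    by (simp_all add: N_def inner_prod_def inner_complex_def)
  have e: "1 / (1 - ?c * a) * ?c = 1 / (sqrt 2 - a)" for a :: real
  proof -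
    have "1 - ?c * a = ?c * (sqrt 2 - a)" by (simp add: right_diff_distrib)
    then show ?thesis by simp
  qed
  show ?thesis
    unfolding link_map_def N x y linear_diff[OF lin] frame_stereo fx fy ix iy scaleR_scaleR e
    by (simp add: vec_eq_iff forall_3)
qed

text \<open>The segments from the torus of the Hopf link to the pinched torus miss the origin. On them the difference
of the first and third coordinates is a positive multiple of \<open>sin S\<close>, and their sum is a multiple of
\<open>sin T\<close> whose coefficient only vanishes at the pinch point, which is off the origin. So a zero could
only occur where both sines vanish, and at these four points the second coordinates of both tori have
the same sign.\<close>

lemma knot_angle_hopf:
  assumes p: "p > 0"
  shows "knot_angle p q (0, 0, 0) (pi/2, 0, 0) (pi/4, 0, 0) = 4 * pi * real (p * q)"
proof -
  let ?G = "link_map (knot_curve p q (pi/4, 0, 0) 0) (knot_curve p q (0, 0, 0)) (knot_curve p q (pi/2, 0, 0))"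
  obtain x' y' where xy: "smooth_loop (knot_curve p q (0, 0, 0)) x'" "smooth_loop (knot_curve p q (pi/2, 0, 0)) y'"
    using smooth_loop_knot_curve by blast
  have G: "torus_derivs ?G (\<lambda>s t. frame (knot_curve p q (pi/4, 0, 0) 0) (stereo_deriv (knot_curve p q (pi/4, 0, 0) 0) (knot_curve p q (0, 0, 0) s) (x' s)))
     (\<lambda>s t. - frame (knot_curve p q (pi/4, 0, 0) 0) (stereo_deriv (knot_curve p q (pi/4, 0, 0) 0) (knot_curve p q (pi/2, 0, 0) t) (y' t))) (\<lambda>s t. 0)"
    by (intro torus_derivs_link_map knot_curve_S3 xy separated_disjoint) (auto simp: separated_def)
  have eq: "solid_angle ?G = solid_angle (pinched_torus p q k)" if k: "0 < k" "k \<le> 1 / 2" for k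
  proof (rule solid_angle_linear_homotopy[OF G torus_derivs_pinched_torus])
    fix r s t :: real assume r: "r \<in> {0..1}"
    define S T where "S = 2 * pi * real p * s" and "T = 2 * pi * real q * t"
    define a b u where "a = sqrt 2 - cos S" and "b = sqrt 2 - cos T" and "u = 1 - cos S"
    have s2: "sqrt 2 > 1" by simp
    have ab: "a > 0" "b > 0" "u \<ge> 0"
      using s2 cos_le_one[of S] cos_le_one[of T] unfolding a_def b_def u_def by linarith+
    show "?G s t + r *\<^sub>R (pinched_torus p q k s t - ?G s t) \<noteq> 0" (is "?v \<noteq> 0")
    proof
      assume v: "?v = 0"
      have Gv: "?G s t = vector [sin S / a - sin T / b, - cos S / a - cos T / b, - sin S / a - sin T / b]"
        using hopf_link_map[of p q s t] by (simp add: S_def T_def a_def b_def)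
      have Mv: "pinched_torus p q k s t = vector [sin S - u * sin T, - sqrt 2 * (u * cos T + k), - sin S - u * sin T]"
        by (simp add: pinched_torus_def Let_def S_def T_def u_def)
      have v1: "?v $ 1 = 0" "?v $ 2 = 0" "?v $ 3 = 0" using v by simp_all
      have e1: "sin S / a - sin T / b + r * ((sin S - u * sin T) - (sin S / a - sin T / b)) = 0"
        and e2: "- cos S / a - cos T / b + r * (- sqrt 2 * (u * cos T + k) - (- cos S / a - cos T / b)) = 0"
        and e3: "- sin S / a - sin T / b + r * ((- sin S - u * sin T) - (- sin S / a - sin T / b)) = 0"
        using v1 unfolding Gv Mv by simp_all
      have comb: "2 * (x * ((1 - r) * \<alpha> + r * m)) = 0" "2 * (y * ((1 - r) * \<beta> + r * u)) = 0"
        if "x * \<alpha> - y * \<beta> + r * ((x * m - u * y) - (x * \<alpha> - y * \<beta>)) = 0"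
          "- x * \<alpha> - y * \<beta> + r * ((- x * m - u * y) - (- x * \<alpha> - y * \<beta>)) = 0" for x y \<alpha> \<beta> m u :: real
        using that by algebra+
      note comb' = comb[of "sin S" "1 / a" "sin T" "1 / b" 1 u]
      have "2 * (sin S * ((1 - r) * (1 / a) + r)) = 0"
        using comb'(1) e1 e3 by simp
      moreover have "(1 - r) * (1 / a) + r > 0"
        using r ab(1) by (cases "r = 0") (auto intro!: add_nonneg_pos)
      ultimately have "sin S = 0" by simp
      have "2 * (sin T * ((1 - r) * (1 / b) + r * u)) = 0"
        using comb'(2) e1 e3 by simp
      then consider "sin T = 0" | "(1 - r) * (1 / b) + r * u = 0" by auto
      then show False
      proof cases
        case 1
        then have cs: "cos S = 1 \<or> cos S = -1" "cos T = 1 \<or> cos T = -1"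
          using \<open>sin S = 0\<close> sin_cos_squared_add[of S] sin_cos_squared_add[of T] power2_eq_1_iff by auto
        define g m where "g = - cos S / a - cos T / b" and "m = - sqrt 2 * (u * cos T + k)"
        have "g < 0 \<and> m < 0 \<or> g > 0 \<and> m > 0"
        proof -
          define w where "w = sqrt 2"
          have "w > 1" by (simp add: w_def)
          then show ?thesis
            using cs k unfolding g_def m_def a_def b_def u_def w_def[symmetric]
            by (auto simp: divide_simps mult_less_0_iff zero_less_mult_iff)
        qed
        moreover have "(1 - r) * g + r * m = 0"
          using e2 unfolding g_def[symmetric] m_def[symmetric] by (simp add: algebra_simps)
        moreover have "(1 - r) * g + r * m < 0" if "g < 0" "m < 0"
          using that r mult_nonneg_nonpos[of "1 - r" g] mult_nonneg_nonpos[of r m]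
          by (cases "r = 0") (auto intro!: add_nonpos_neg mult_pos_neg)
        moreover have "(1 - r) * g + r * m > 0" if "g > 0" "m > 0"
          using that r by (cases "r = 0") (auto intro!: add_nonneg_pos)
        ultimately show False by force
      next
        case 2
        moreover have "(1 - r) * (1 / b) \<ge> 0" "r * u \<ge> 0" using r ab by auto
        ultimately have "(1 - r) * (1 / b) = 0" "r * u = 0" by linarith+
        then have "r = 1" "u = 0" using ab by auto
        then show False using e2 k by simp
      qed
    qed
  qed
  have "solid_angle (pinched_torus p q (1 / (real n + 2))) = solid_angle ?G" for n
    using eq[of "1 / (real n + 2)"] by (simp add: divide_simps)
  then have "(\<lambda>n::nat. solid_angle ?G) \<longlonglongrightarrow> 4 * pi * real (p * q)"
    using solid_angle_pinched_torus_limit[OF p, of q] by simp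
  then show ?thesis
    unfolding knot_angle_def using LIMSEQ_unique tendsto_const by blast
qed

text \<open>Used to make phases generic: a small change of \<open>D\<close> moves it off \<open>2 \<pi> \<int>\<close>.\<close>

lemma avoid_Ints:
  fixes D :: real
  shows "\<exists>e>0. \<forall>x. 0 < \<bar>x\<bar> \<and> \<bar>x\<bar> < e \<longrightarrow> (D + x) / (2 * pi) \<notin> \<int>"
proof -
  have "closed (\<int> - {D / (2 * pi)})" by (rule closed_subset_Ints) auto
  then have "open (- (\<int> - {D / (2 * pi)}))" by (simp only: open_Compl)
  then obtain e where e: "e > 0" "ball (D / (2 * pi)) e \<subseteq> - (\<int> - {D / (2 * pi)})"
    by (meson ComplI DiffD2 open_contains_ball singletonI)
  have "(D + x) / (2 * pi) \<notin> \<int>" if x: "0 < \<bar>x\<bar>" "\<bar>x\<bar> < 2 * pi * e" for x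
  proof -
    have "\<bar>x / (2 * pi)\<bar> < e" using x by (simp add: field_simps)
    then have "(D + x) / (2 * pi) \<in> ball (D / (2 * pi)) e"
      by (simp add: dist_real_def add_divide_distrib)
    then have "(D + x) / (2 * pi) \<in> - (\<int> - {D / (2 * pi)})" using e(2) by blast
    moreover have "(D + x) / (2 * pi) \<noteq> D / (2 * pi)" using x by auto
    ultimately show ?thesis by blast
  qed
  then show ?thesis using e(1) by (intro exI[of _ "2 * pi * e"]) auto
qed

text \<open>A small change of phases makes the three values of \<open>q u - p v\<close> pairwise different modulo \<open>2 \<pi>\<close>.
Then the angles \<open>\<theta>\<close> can be moved linearly to \<open>0\<close>, \<open>\<pi>/2\<close> and \<open>\<pi>/4\<close>: at no time are two of the
points on the same exceptional fiber, and on regular fibers they differ by their phases. With distinct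
values of \<open>\<theta>\<close> the phases are free to move to \<open>0\<close>.\<close>

lemma knot_angle_eq:
  fixes A B C :: angles
  assumes p: "p > 0" and q: "q > 0"
    and valid: "fst A \<in> {0..pi/2}" "fst B \<in> {0..pi/2}" "fst C \<in> {0..pi/2}"
    and sep: "separated p q A B" "separated p q A C" "separated p q B C"
  shows "knot_angle p q A B C = 4 * pi * real (p * q)"
proof -
  define D where "D X Y = real q * (fst (snd X) - fst (snd Y)) - real p * (snd (snd X) - snd (snd Y))" for X Y :: angles
  obtain e1 where e1: "e1 > 0" "\<And>x. 0 < \<bar>x\<bar> \<Longrightarrow> \<bar>x\<bar> < e1 \<Longrightarrow> (D A B + x) / (2 * pi) \<notin> \<int>" using avoid_Ints by blast
  obtain e2 where e2: "e2 > 0" "\<And>x. 0 < \<bar>x\<bar> \<Longrightarrow> \<bar>x\<bar> < e2 \<Longrightarrow> (D A C + x) / (2 * pi) \<notin> \<int>" using avoid_Ints by blast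
  obtain e3 where e3: "e3 > 0" "\<And>x. 0 < \<bar>x\<bar> \<Longrightarrow> \<bar>x\<bar> < e3 \<Longrightarrow> (D B C + x) / (2 * pi) \<notin> \<int>" using avoid_Ints by blast
  \<comment> \<open>The three phase differences change by \<open>q h\<close>, \<open>- q h\<close> and \<open>- 2 q h\<close>, all below the bounds.\<close>
  define h where "h = min e1 (min e2 e3) / (4 * real q)"
  have "0 < min e1 (min e2 e3)" using e1(1) e2(1) e3(1) by simp
  then have h: "h > 0" "2 * (real q * h) < min e1 (min e2 e3)" using q by (auto simp: h_def)
  define A1 C1 where "A1 = A + (0, h, 0)" and "C1 = C + (0, 2 * h, 0)"
  have bd: "0 < \<bar>c * (r * (real q * h))\<bar>" "\<bar>c * (r * (real q * h))\<bar> < min e1 (min e2 e3)"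
    if "0 < r" "r \<le> 1" "c \<in> {1, -1, -2}" for r c :: real
  proof -
    have "\<bar>c\<bar> \<le> 2" "0 < \<bar>c\<bar>" using that by auto
    moreover have rq: "r * (real q * h) \<le> real q * h" "0 < r * (real q * h)"
      using that h q by (auto intro!: mult_left_le_one_le)
    ultimately have "\<bar>c\<bar> * (r * (real q * h)) \<le> 2 * (real q * h)"
      using mult_mono[of "\<bar>c\<bar>" 2 "r * (real q * h)" "real q * h"] by simp
    moreover have "\<bar>c * (r * (real q * h))\<bar> = \<bar>c\<bar> * (r * (real q * h))"
      unfolding abs_mult[of c] using abs_of_pos[OF rq(2)] by (rule arg_cong)
    ultimately show "\<bar>c * (r * (real q * h))\<bar> < min e1 (min e2 e3)" using h(2) by linarith
    show "0 < \<bar>c * (r * (real q * h))\<bar>" using mult_pos_pos[OF \<open>0 < \<bar>c\<bar>\<close> rq(2)] rq(2) unfolding abs_mult[of c] by simp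
  qed
  have gen: "(D A B + r * (real q * h)) / (2 * pi) \<notin> \<int>" "(D A C - r * (real q * h)) / (2 * pi) \<notin> \<int>"
    "(D B C - 2 * (r * (real q * h))) / (2 * pi) \<notin> \<int>" if "0 < r" "r \<le> 1" for r
    using e1(2)[of "1 * (r * (real q * h))"] e2(2)[of "(-1) * (r * (real q * h))"] e3(2)[of "(-2) * (r * (real q * h))"]
      bd[OF that, of 1] bd[OF that, of "-1"] bd[OF that, of "-2"] by auto
  have step1: "knot_angle p q A B C = knot_angle p q A1 B C1"
  proof (rule knot_angle_path)
    fix r :: real assume r: "r \<in> {0..1}"
    show "separated p q (A + r *\<^sub>R (A1 - A)) (B + r *\<^sub>R (B - B)) \<and>
      separated p q (A + r *\<^sub>R (A1 - A)) (C + r *\<^sub>R (C1 - C)) \<and>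
      separated p q (B + r *\<^sub>R (B - B)) (C + r *\<^sub>R (C1 - C))"
    proof (cases "r = 0")
      case False
      then show ?thesis
        using gen[of r] r sep unfolding separated_def A1_def C1_def D_def
        by (auto simp: algebra_simps)
    qed (use sep in simp)
  qed (use valid in \<open>auto simp: A1_def C1_def\<close>)
  have g1: "D A1 B / (2 * pi) \<notin> \<int>" "D A1 C1 / (2 * pi) \<notin> \<int>" "D B C1 / (2 * pi) \<notin> \<int>"
    using gen[of 1] by (auto simp: D_def A1_def C1_def algebra_simps)
  have sep1: "separated p q A1 B" "separated p q A1 C1" "separated p q B C1"
    using sep g1 unfolding separated_def D_def by (auto simp: A1_def C1_def)
  have valid1: "fst A1 \<in> {0..pi/2}" "fst C1 \<in> {0..pi/2}" using valid by (auto simp: A1_def C1_def)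
  define A2 B2 C2 where "A2 = (0::real, snd A1)" and "B2 = (pi/2, snd B)" and "C2 = (pi/4, snd C1)"
  have step2: "knot_angle p q A1 B C1 = knot_angle p q A2 B2 C2"
  proof (rule knot_angle_path)
    fix r :: real assume r: "r \<in> {0..1}"
    let ?A = "A1 + r *\<^sub>R (A2 - A1)" and ?B = "B + r *\<^sub>R (B2 - B)" and ?C = "C1 + r *\<^sub>R (C2 - C1)"
    show "separated p q ?A ?B \<and> separated p q ?A ?C \<and> separated p q ?B ?C"
    proof (cases "r = 0")
      case False
      then have r0: "r > 0" "r \<le> 1" using r by auto
      have D': "D ?A ?B = D A1 B" "D ?A ?C = D A1 C1" "D ?B ?C = D B C1"
        by (simp_all add: D_def A2_def B2_def C2_def)
      have f: "fst ?A = (1 - r) * fst A1" "fst ?B = (1 - r) * fst B + r * (pi/2)" "fst ?C = (1 - r) * fst C1 + r * (pi/4)"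
        by (simp_all add: A2_def B2_def C2_def algebra_simps)
      have n: "0 \<le> (1 - r) * fst X" "(1 - r) * fst X \<le> (1 - r) * (pi/2)" if "fst X \<in> {0..pi/2}" for X :: angles
      proof -
        show "0 \<le> (1 - r) * fst X" using that r0 by simp
        show "(1 - r) * fst X \<le> (1 - r) * (pi/2)" using that r0 by (intro mult_left_mono) auto
      qed
      have rp: "r * pi > 0" using r0 by simp
      have "fst ?A < pi/2" "0 < fst ?B" "0 < fst ?C" "fst ?C < pi/2"
        unfolding f using n[OF valid1(1)] n[OF valid1(2)] n[OF valid(2)] rp by (auto simp: algebra_simps)
      then show ?thesis
        using g1 D' unfolding separated_def D_def by auto
    qed (use sep1 in simp)
  qed (use valid valid1 in \<open>auto simp: A2_def B2_def C2_def\<close>)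
  have step3: "knot_angle p q A2 B2 C2 = knot_angle p q (0, 0, 0) (pi/2, 0, 0) (pi/4, 0, 0)"
    by (rule knot_angle_path) (auto simp: A2_def B2_def C2_def separated_def)
  show ?thesis unfolding step1 step2 step3 by (rule knot_angle_hopf[OF p])
qed

section \<open>Gauss' integral of two fibers\<close>

lemma integral_rescale:
  fixes f :: "real \<Rightarrow> real"
  assumes "m > 0"
  shows "integral {0..c * m} (\<lambda>x. f (x / m)) = m * integral {0..c} f"
proof -
  have "(\<lambda>x. x / (1 / m)) ` {0..c} = {0..c * m}"
    using assms by (auto simp: image_iff field_simps intro!: bexI[of _ "_ / m"])
  then show ?thesis
    using integral_stretch_real[of "1 / m" 0 c f] assms by simp
qed

lemma det4_minus: "det4 (- N) u v w = - det4 N u v w"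
  by (simp add: det4_def coords_def det_4 det_3 vector_4 algebra_simps)

lemma periodic_fundamental_domain:
  fixes c :: real
  assumes per: "\<And>s. f (s + c) = f s" and c: "c > 0"
  shows "\<exists>s'\<in>{0..c}. f s' = f s"
proof -
  define j where "j = \<lfloor>s / c\<rfloor>"
  have j: "of_int j * c \<le> s" "s < of_int j * c + c"
    using floor_divide_lower[OF c, of s] floor_divide_upper[OF c, of s] by (auto simp: j_def algebra_simps)
  have "f (s - of_int j * c) = f s"
  proof (cases "j \<ge> 0")
    case True
    then show ?thesis using periodic_nat[of f c "s - of_int j * c" "nat j", OF per] by simp
  next
    case False
    then have e: "s - of_int j * c = s + real (nat (- j)) * c" by simp
    show ?thesis unfolding e by (rule periodic_nat[of f, OF per])
  qed
  then show ?thesis using j by (intro bexI[of _ "s - of_int j * c"]) auto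
qed

text \<open>In the frame coordinates Gauss' integrand is the solid angle integrand of \<open>link_map\<close>, up to the
rescaling of time by \<open>m\<close> and \<open>n\<close>. The parametrization of the first curve on \<open>[0, m/k]\<close> covers only the
\<open>k\<close>-th part of the torus, over which the integral is the \<open>k\<close>-th part by periodicity. Since the pole is some
unspecified point off the curves, the solid angle has to be known for all of them.\<close>

lemma linking_number_eq_solid_angle:
  assumes x: "smooth_loop x x'" and y: "smooth_loop y y'" and dis: "\<And>s t. x s \<noteq> y t"
    and k: "k > 0" and per: "\<And>s. x (s + 1 / real k) = x s" and m: "m > 0" and n: "n > 0"
    and ex: "\<exists>N\<in>S3. N \<notin> range x \<and> N \<notin> range y"
    and angle: "\<And>N. N \<in> S3 \<Longrightarrow> N \<notin> range x \<Longrightarrow> N \<notin> range y \<Longrightarrow> solid_angle (link_map N x y) = \<Omega>"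
  shows "linking_number (\<lambda>t. x (t / m)) (m / real k) (\<lambda>t. y (t / n)) n = \<Omega> / (4 * pi * real k)"
proof -
  let ?P = "\<lambda>N. N \<in> S3 \<and> N \<notin> (\<lambda>t. x (t / m)) ` {0..m / real k} \<and> N \<notin> (\<lambda>t. y (t / n)) ` {0..n}"
  define N where "N = (SOME N. ?P N)"
  have "\<exists>N. ?P N" using ex by blast
  then have N: "?P N" unfolding N_def by (rule someI_ex)
  have Nx: "x s \<noteq> N" for s
  proof -
    obtain s' where s': "s' \<in> {0..1 / real k}" "x s' = x s"
      using periodic_fundamental_domain[of x "1 / real k" s] per k by auto
    then have "m * s' \<in> {0..m / real k}" "x s' = x (m * s' / m)"
      using m mult_left_mono[of s' "1 / real k" m] by auto
    then show ?thesis using N s'(2) by (metis image_eqI)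
  qed
  have Ny: "y s \<noteq> N" for s
  proof -
    obtain s' where s': "s' \<in> {0..1}" "y s' = y s"
      using periodic_fundamental_domain[of y 1 s] y by (auto simp: smooth_loop_def)
    then have "n * s' \<in> {0..n}" "y s' = y (n * s' / n)"
      using n mult_left_mono[of s' 1 n] by auto
    then show ?thesis using N s'(2) by (metis image_eqI)
  qed
  have N1: "N \<in> S3" "norm N = 1" "N \<bullet> N = 1" using N by (auto simp: norm_eq_1)
  have S3: "x s \<in> S3" "y s \<in> S3" for s using x y by (auto simp: smooth_loop_def)
  define X where "X s = stereo_deriv N (x s) (x' s)" for s
  define Y where "Y t = stereo_deriv N (y t) (y' t)" for t
  have tor: "torus_derivs (link_map N x y) (\<lambda>s t. frame N (X s)) (\<lambda>s t. - frame N (Y t)) (\<lambda>s t. 0)"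
    unfolding X_def Y_def by (rule torus_derivs_link_map[OF N1(1) x Nx y Ny])
  define D where "D s t = solid_form (link_map N x y s t) (frame N (X s)) (- frame N (Y t))" for s t
  have nz: "link_map N x y s t \<noteq> 0" for s t
    using link_map_nonzero[of N x s y t] N1 S3 Nx Ny dis by blast
  have pos: "1 - x s \<bullet> N \<noteq> 0" "1 - y s \<bullet> N \<noteq> 0" for s
    using one_minus_inner_pos[of "x s" N] one_minus_inner_pos[of "y s" N] S3[of s] N1 Nx Ny
    by (auto simp: less_imp_neq)
  have dX: "((\<lambda>s. stereo N (x s)) has_vector_derivative X s) (at s)"
    and dY: "((\<lambda>s. stereo N (y s)) has_vector_derivative Y s) (at s)" for s
    using x y pos unfolding X_def Y_def by (auto intro!: has_vector_derivative_stereo simp: smooth_loop_def)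
  have scale: "((\<lambda>s. f (s / c)) has_vector_derivative (1 / c) *\<^sub>R f') (at s)"
    if "(f has_vector_derivative f') (at (s / c))" for f :: "real \<Rightarrow> C2" and f' s and c :: real
  proof -
    have "((\<lambda>s. s / c) has_vector_derivative 1 / c) (at s)"
      by (auto intro!: derivative_eq_intros)
    from vector_diff_chain_at[OF this that] show ?thesis by (simp add: o_def)
  qed
  have vX: "vector_derivative (\<lambda>s. stereo N (x (s / m))) (at s) = (1 / m) *\<^sub>R X (s / m)"
    and vY: "vector_derivative (\<lambda>s. stereo N (y (s / n))) (at s) = (1 / n) *\<^sub>R Y (s / n)" for s
    using scale[OF dX] scale[OF dY] by (auto intro: vector_derivative_at)
  have integrand: "det4 (- N) (stereo N (x s) - stereo N (y t)) ((1 / m) *\<^sub>R X s) ((1 / n) *\<^sub>R Y t)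
      / norm (stereo N (x s) - stereo N (y t)) ^ 3 = 1 / (m * n) * D s t" for s t
  proof -
    have lin: "linear (frame N)" using bounded_linear_frame bounded_linear.linear by blast
    have "det4 (- N) (stereo N (x s) - stereo N (y t)) ((1 / m) *\<^sub>R X s) ((1 / n) *\<^sub>R Y t)
        = - triple (link_map N x y s t) ((1 / m) *\<^sub>R frame N (X s)) ((1 / n) *\<^sub>R frame N (Y t))"
      unfolding det4_minus link_map_def linear_scale[OF lin, symmetric] det4_frame N1 by simp
    also have "\<dots> = 1 / (m * n) * triple (link_map N x y s t) (frame N (X s)) (- frame N (Y t))"
      by (simp add: triple_explicit algebra_simps)
    moreover have "norm (stereo N (x s) - stereo N (y t)) = norm (link_map N x y s t)"
      unfolding link_map_def using N1 by (intro norm_frame[symmetric]) (auto simp: inner_diff_left stereo_orthogonal)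
    ultimately show ?thesis by (simp add: D_def solid_form_def)
  qed
  have contD: "continuous_on UNIV (\<lambda>z. D (fst z) (snd z))"
    unfolding D_def using tor nz unfolding torus_derivs_def by (intro continuous_on_solid_form) auto
  note cD = continuous_on_pair_apply[OF contD]
  define g where "g s = integral {0..1} (D s)" for s
  have cg: "continuous_on UNIV g"
    using integral_continuous_on_param[of UNIV 0 1 D] unfolding g_def
    by (simp add: split_beta cD continuous_on_fst continuous_on_snd)
  have Xper: "X (s + 1 / real k) = X s" for s
  proof -
    have "((\<lambda>s. s + 1 / real k) has_vector_derivative 1) (at s)"
      by (auto intro!: derivative_eq_intros)
    from vector_diff_chain_at[OF this dX[of "s + 1 / real k"]]
    have "((\<lambda>s. stereo N (x (s + 1 / real k))) has_vector_derivative X (s + 1 / real k)) (at s)"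
      by (simp add: o_def)
    then show ?thesis unfolding per using dX vector_derivative_unique_at by blast
  qed
  have gper: "g (s + 1 / real k) = g s" for s
  proof -
    have "D (s + 1 / real k) = D s"
      by (rule ext) (simp only: D_def Xper link_map_def per)
    then show ?thesis by (simp only: g_def)
  qed
  have "integral (cbox (0, 0) (m / real k, n)) (\<lambda>(s, t). 1 / (m * n) * D (s / m) (t / n))
      = integral {0..m / real k} (\<lambda>s. integral {0..n} (\<lambda>t. 1 / (m * n) * D (s / m) (t / n)))"
    using integral_prod_continuous[of 0 0 "m / real k" n "\<lambda>(s, t). 1 / (m * n) * D (s / m) (t / n)"] m n
    by (simp add: split_beta) (subst integral_prod_continuous, auto intro!: continuous_intros cD simp: split_beta)
  also have "\<dots> = integral {0..m / real k} (\<lambda>s. 1 / m * g (s / m))"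
  proof (rule Henstock_Kurzweil_Integration.integral_cong)
    fix s
    show "integral {0..n} (\<lambda>t. 1 / (m * n) * D (s / m) (t / n)) = 1 / m * g (s / m)"
      using integral_rescale[OF n, of 1 "D (s / m)"] n by (simp add: g_def)
  qed
  also have "\<dots> = integral {0..1 / real k} g"
    using integral_rescale[OF m, of "1 / real k" g] m by simp
  also have "\<dots> = integral {0..real k * (1 / real k)} g / real k"
    using integral_subdivide_periodic[OF cg gper, of k] k by simp
  also have "integral {0..real k * (1 / real k)} g = solid_angle (link_map N x y)"
    using k unfolding solid_angle_derivs[OF tor] D_def[symmetric] g_def
    by (subst integral_prod_continuous) (auto intro!: cD continuous_intros simp: split_beta)
  finally have "integral (cbox (0, 0) (m / real k, n)) (\<lambda>(s, t). 1 / (m * n) * D (s / m) (t / n)) = \<Omega> / real k"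
    using angle[OF N1(1)] Nx Ny by auto
  then show ?thesis
    unfolding linking_number_def N_def[symmetric] Let_def vX vY integrand by simp
qed

lemma knot_curve_polar:
  assumes "z \<in> S3"
  shows "\<exists>A. fst A \<in> {0..pi/2} \<and> knot_curve p q A 0 = z"
proof -
  have "(norm (fst z))\<^sup>2 + (norm (snd z))\<^sup>2 = 1" using assms by (simp add: norm_prod_def)
  then obtain \<theta> where \<theta>: "0 \<le> \<theta>" "\<theta> \<le> pi/2" "norm (fst z) = cos \<theta>" "norm (snd z) = sin \<theta>"
    using sincos_total_pi_half[of "norm (fst z)" "norm (snd z)"] by auto
  then have "knot_curve p q (\<theta>, Arg (fst z), Arg (snd z)) 0 = z"
    using rcis_cmod_Arg[of "fst z"] rcis_cmod_Arg[of "snd z"]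
    by (simp add: knot_curve_def rcis_def prod_eq_iff)
  then show ?thesis using \<theta> by (intro exI[of _ "(\<theta>, Arg (fst z), Arg (snd z))"]) auto
qed

text \<open>With \<open>k = 1\<close> this is the linking number of two regular fibers; with \<open>k = p\<close> or \<open>k = q\<close> the first
curve may be an exceptional fiber that is run through once.\<close>

lemma linking_number_knot_curves:
  assumes pq: "p > 0" "q > 0" "coprime p q" and A: "fst A \<in> {0..pi/2}" and B: "fst B \<in> {0..pi/2}"
    and dis: "\<And>s t. knot_curve p q A s \<noteq> knot_curve p q B t"
    and k: "k > 0" "\<And>s. knot_curve p q A (s + 1 / real k) = knot_curve p q A s" and m: "m > 0" and n: "n > 0"
  shows "linking_number (\<lambda>t. knot_curve p q A (t / m)) (m / real k) (\<lambda>t. knot_curve p q B (t / n)) n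
    = real (p * q) / real k"
proof -
  obtain x' y' where x: "smooth_loop (knot_curve p q A) x'" and y: "smooth_loop (knot_curve p q B) y'"
    using smooth_loop_knot_curve by blast
  have "linking_number (\<lambda>t. knot_curve p q A (t / m)) (m / real k) (\<lambda>t. knot_curve p q B (t / n)) n
    = 4 * pi * real (p * q) / (4 * pi * real k)"
  proof (rule linking_number_eq_solid_angle[OF x y dis k m n])
    \<comment> \<open>One of three fibers differs from the two given ones.\<close>
    obtain \<theta> where \<theta>: "\<theta> \<in> {0, pi/4, pi/2}" "\<theta> \<noteq> fst A" "\<theta> \<noteq> fst B"
    proof -
      have "0 \<noteq> pi/4" "0 \<noteq> pi/2" "pi/4 \<noteq> pi/2" by auto
      then show ?thesis using that by (metis insertI1 insert_iff)
    qed
    define C where "C = (\<theta>, 0::real, 0::real)"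
    have C: "fst C \<in> {0..pi/2}"
      using \<theta>(1) by (auto simp: C_def) (use pi_ge_zero in linarith)+
    have "separated p q A C" "separated p q B C"
      using \<theta>(2,3) by (auto simp: separated_def C_def)
    then have "knot_curve p q A s \<noteq> knot_curve p q C 0" "knot_curve p q B s \<noteq> knot_curve p q C 0" for s
      using separated_disjoint A B C by blast+
    then show "\<exists>N\<in>S3. N \<notin> range (knot_curve p q A) \<and> N \<notin> range (knot_curve p q B)"
      using knot_curve_S3[of p q C 0] by (metis rangeE)
  next
    fix N assume N: "N \<in> S3" "N \<notin> range (knot_curve p q A)" "N \<notin> range (knot_curve p q B)"
    obtain C where C: "fst C \<in> {0..pi/2}" "knot_curve p q C 0 = N" using knot_curve_polar[OF N(1)] by blast
    have "knot_curve p q A s \<noteq> knot_curve p q C 0" "knot_curve p q B s \<noteq> knot_curve p q C 0" for s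
      using N C(2) by (metis rangeI)+
    then have "separated p q A B" "separated p q A C" "separated p q B C"
      using disjoint_separated[OF pq] A B dis by blast+
    from knot_angle_eq[OF pq(1,2) A B C(1) this]
    show "solid_angle (link_map N (knot_curve p q A) (knot_curve p q B)) = 4 * pi * real (p * q)"
      by (simp add: knot_angle_def C(2))
  qed
  then show ?thesis by simp
qed

lemma act_knot_curve: "act p q (cis (2 * pi * s)) (knot_curve p q A 0) = knot_curve p q A s"
  by (simp add: act_def knot_curve_def Complex.DeMoivre cis_mult[symmetric] mult_ac)

section \<open>The Reeb vector field over a critical point\<close>

text \<open>The generator of the circle action.\<close>

definition orbit_direction :: "nat \<Rightarrow> nat \<Rightarrow> C2 \<Rightarrow> C2" where
  "orbit_direction p q z = ((2 * pi * real p) *\<^sub>R (\<i> * fst z), (2 * pi * real q) *\<^sub>R (\<i> * snd z))"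

lemma act_mult: "act p q c (act p q d z) = act p q (c * d) z"
  by (simp add: act_def power_mult_distrib mult_ac)

lemma act_1: "act p q 1 z = z"
  by (simp add: act_def)

lemma norm_act: "norm c = 1 \<Longrightarrow> norm (act p q c z) = norm z"
  by (simp add: act_def norm_prod_def norm_mult norm_power)

lemma fiber_act:
  assumes "norm c = 1"
  shows "fiber p q (act p q c z) = fiber p q z"
proof -
  have c0: "c \<noteq> 0" using assms by auto
  show ?thesis
    unfolding fiber_def act_mult
  proof (intro equalityI subsetI; clarsimp)
    show "\<exists>d'. act p q (d * c) z = act p q d' z \<and> cmod d' = 1" if "cmod d = 1" for d
      using that assms by (intro exI[of _ "d * c"]) (simp add: norm_mult)
    show "\<exists>d'. act p q d z = act p q (d' * c) z \<and> cmod d' = 1" if "cmod d = 1" for d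
      using that assms c0 by (intro exI[of _ "d / c"]) (simp add: norm_divide)
  qed
qed

lemma fiber_self: "z \<in> fiber p q z"
  unfolding fiber_def using act_1 by (metis (mono_tags, lifting) mem_Collect_eq norm_one)

lemma fiber_eq:
  assumes "w \<in> fiber p q z"
  shows "fiber p q w = fiber p q z"
proof -
  obtain c where "norm c = 1" "w = act p q c z" using assms unfolding fiber_def by blast
  then show ?thesis by (simp add: fiber_act)
qed

lemma CP1_fiber: "x \<in> CP1 p q \<Longrightarrow> z \<in> x \<Longrightarrow> x = fiber p q z \<and> z \<in> S3"
  unfolding CP1_def by (auto simp: fiber_eq) (auto simp: fiber_def norm_act)

lemma pullback_S3: "z \<in> S3 \<Longrightarrow> pullback p q H z = H (fiber p q z)"
  by (simp add: pullback_def sgn_div_norm)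

lemma pullback_act:
  assumes "norm c = 1"
  shows "pullback p q H (act p q c z) = pullback p q H z"
proof -
  have "sgn (act p q c z) = act p q c (sgn z)"
    using assms by (simp add: sgn_div_norm norm_act) (simp add: act_def scaleR_conv_of_real)
  then show ?thesis using assms by (simp add: pullback_def fiber_act)
qed

lemma act_has_vector_derivative:
  "((\<lambda>t. act p q (cis (2 * pi * (t / m))) z) has_vector_derivative
     (1 / m) *\<^sub>R orbit_direction p q (act p q (cis (2 * pi * (t / m))) z)) (at t)"
proof -
  have e: "cis (2 * pi * (t / m)) ^ n = cis ((2 * pi * real n / m) * t)" for n t
    unfolding Complex.DeMoivre by (rule arg_cong[of _ _ cis]) simp
  have d: "((\<lambda>t. cis ((2 * pi * real n / m) * t) * a) has_vector_derivative
      (1 / m) *\<^sub>R (2 * pi * real n) *\<^sub>R (\<i> * (cis ((2 * pi * real n / m) * t) * a))) (at t)" for n a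
    unfolding has_vector_derivative_def
    by (rule derivative_eq_intros refl)+ (simp add: scaleR_conv_of_real mult_ac)
  show ?thesis
    unfolding act_def orbit_direction_def e fst_conv snd_conv scaleR_Pair
    by (intro has_vector_derivative_Pair d)
qed

lemma smooth_pullback_differentiable:
  assumes "smooth_on (- {0}) F" "z \<noteq> 0"
  shows "(F has_derivative frechet_derivative F (at z)) (at z)"
proof -
  have "Ck_on (Suc 0) (- {0}) F" using assms(1) by (simp only: smooth_on_def)
  then have "F differentiable (at z)" using assms(2) by (auto simp: differentiable_def)
  then show ?thesis by (simp add: frechet_derivative_works)
qed

text \<open>The pullback is constant along the circle action.\<close>

lemma pullback_derivative_orbit_direction:
  assumes "(pullback p q H has_derivative F') (at z)"
  shows "F' (orbit_direction p q z) = 0"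
proof -
  let ?\<gamma> = "\<lambda>t. act p q (cis (2 * pi * (t / 1))) z"
  have "(?\<gamma> has_vector_derivative orbit_direction p q z) (at 0)"
    using act_has_vector_derivative[of p q 1 z 0] by (simp add: act_1)
  then have "(?\<gamma> has_derivative (\<lambda>h. h *\<^sub>R orbit_direction p q z)) (at 0)"
    by (simp add: has_vector_derivative_def)
  moreover have "(pullback p q H has_derivative F') (at (?\<gamma> 0))"
    using assms by (simp add: act_1)
  ultimately have "((\<lambda>t. pullback p q H (?\<gamma> t)) has_derivative (\<lambda>h. F' (h *\<^sub>R orbit_direction p q z))) (at 0)"
    by (rule has_derivative_compose)
  moreover have "(\<lambda>t. pullback p q H (?\<gamma> t)) = (\<lambda>t. pullback p q H z)"
    by (simp add: pullback_act)
  ultimately have "(\<lambda>h::real. F' (h *\<^sub>R orbit_direction p q z)) = (\<lambda>h. 0)"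
    using has_derivative_unique has_derivative_const by metis
  from fun_cong[OF this, of 1] show ?thesis by simp
qed

lemma lambda0_eq: "lambda0 z w = (\<i> * fst z, \<i> * snd z) \<bullet> w"
  by (simp add: lambda0_def inner_prod_def inner_complex_def field_simps)

text \<open>The denominator in \<open>lambda_pq\<close>, in a form that is easy to differentiate.\<close>

definition weight :: "nat \<Rightarrow> nat \<Rightarrow> C2 \<Rightarrow> real" where
  "weight p q z = real p * (fst z \<bullet> fst z) + real q * (snd z \<bullet> snd z)"

lemma lambda_pqe_eq:
  "lambda_pqe p q H \<epsilon> z w = (1 + \<epsilon> * pullback p q H z) / (2 * pi * weight p q z) * lambda0 z w"
  by (simp add: lambda_pqe_def lambda_pq_def weight_def power2_norm_eq_inner)

lemma weight_pos:
  assumes "p > 0" "q > 0" "z \<noteq> 0"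
  shows "weight p q z > 0"
proof (cases "fst z = 0")
  case True
  then have "snd z \<noteq> 0" using assms(3) by (metis prod.collapse zero_prod_def)
  then show ?thesis using assms True by (simp add: weight_def)
next
  case False
  then show ?thesis using assms by (auto simp: weight_def intro!: add_pos_nonneg)
qed

lemma lambda0_orbit_direction: "lambda0 z (orbit_direction p q z) = 2 * pi * weight p q z"
  by (simp add: lambda0_eq orbit_direction_def weight_def inner_prod_def inner_complex_def algebra_simps)

lemma orbit_direction_tangent: "orbit_direction p q z \<in> tangent_S3 z"
  by (simp add: tangent_S3_def orbit_direction_def inner_prod_def inner_complex_def)

text \<open>By definition, the derivative at a critical point vanishes on the plane transverse to the action;
it also vanishes along the action.\<close>

lemma critical_derivative_zero:
  assumes pq: "p > 0" "q > 0" and z: "z \<noteq> 0" and F: "(pullback p q H has_derivative F') (at z)"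
    and crit: "\<And>v. v \<in> contact_plane lambda0 z \<Longrightarrow> F' v = 0" and w: "w \<in> tangent_S3 z"
  shows "F' w = 0"
proof -
  let ?R = "orbit_direction p q z"
  define c where "c = lambda0 z w / lambda0 z ?R"
  have R: "lambda0 z ?R \<noteq> 0" using weight_pos[OF pq z] by (simp add: lambda0_orbit_direction)
  have "w - c *\<^sub>R ?R \<in> contact_plane lambda0 z"
    using w orbit_direction_tangent[of p q z] R
    by (auto simp: contact_plane_def tangent_S3_def inner_diff_right c_def lambda0_eq)
  then have "F' (w - c *\<^sub>R ?R) = 0" by (rule crit)
  moreover have lin: "linear F'" using F has_derivative_linear by blast
  ultimately show ?thesis
    using pullback_derivative_orbit_direction[OF F] by (simp add: linear_diff[OF lin] linear_scale[OF lin])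
qed

text \<open>The derivative of the function \<open>f\<close> for which the perturbed form is \<open>f \<lambda>\<^sub>0\<close>, where \<open>F'\<close> is the
derivative of the pullback.\<close>

definition factor_deriv :: "nat \<Rightarrow> nat \<Rightarrow> (C2 set \<Rightarrow> real) \<Rightarrow> real \<Rightarrow> (C2 \<Rightarrow> real) \<Rightarrow> C2 \<Rightarrow> C2 \<Rightarrow> real" where
  "factor_deriv p q H \<epsilon> F' z h = \<epsilon> * F' h / (2 * pi * weight p q z) -
     (1 + \<epsilon> * pullback p q H z) * (2 * real p * (fst z \<bullet> fst h) + 2 * real q * (snd z \<bullet> snd h)) / (2 * pi * (weight p q z)\<^sup>2)"

lemma ext_deriv_lambda_pqe:
  assumes pq: "p > 0" "q > 0" and z: "z \<noteq> 0" and F: "(pullback p q H has_derivative F') (at z)"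
  shows "ext_deriv (lambda_pqe p q H \<epsilon>) z u v =
    factor_deriv p q H \<epsilon> F' z u * lambda0 z v - factor_deriv p q H \<epsilon> F' z v * lambda0 z u
    + 2 * ((1 + \<epsilon> * pullback p q H z) / (2 * pi * weight p q z)) * lambda0 u v"
proof -
  have W: "weight p q z > 0" by (rule weight_pos[OF pq z])
  have dW: "(weight p q has_derivative (\<lambda>h. 2 * real p * (fst z \<bullet> fst h) + 2 * real q * (snd z \<bullet> snd h))) (at z)"
    unfolding weight_def
    by (auto intro!: derivative_eq_intros simp: inner_commute algebra_simps)
  have aux: "- m * (inverse (2 * pi * w) * (2 * pi * d) * inverse (2 * pi * w)) + (0 + e) / (2 * pi * w)
      = e / (2 * pi * w) - m * d / (2 * pi * w\<^sup>2)" if "w > 0" for m w d e :: real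
    using that by (simp add: power2_eq_square inverse_eq_divide)
  have df: "((\<lambda>x. (1 + \<epsilon> * pullback p q H x) / (2 * pi * weight p q x)) has_derivative factor_deriv p q H \<epsilon> F' z) (at z)"
    by (rule has_derivative_eq_rhs[OF has_derivative_divide[OF has_derivative_add[OF has_derivative_const has_derivative_mult_right[OF F]]
       has_derivative_mult_right[OF dW]]])
      (use W in simp, intro ext, unfold factor_deriv_def, rule aux[OF W])
  have dl: "((\<lambda>x. lambda0 x v) has_derivative (\<lambda>h. lambda0 h v)) (at z)" for v
    unfolding lambda0_eq by (auto intro!: derivative_eq_intros)
  have "((\<lambda>x. lambda_pqe p q H \<epsilon> x v) has_derivative (\<lambda>h. (1 + \<epsilon> * pullback p q H z) / (2 * pi * weight p q z) * lambda0 h v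
      + factor_deriv p q H \<epsilon> F' z h * lambda0 z v)) (at z)" for v
    unfolding lambda_pqe_eq by (rule has_derivative_mult[OF df dl])
  then have fd: "frechet_derivative (\<lambda>x. lambda_pqe p q H \<epsilon> x v) (at z) =
     (\<lambda>h. (1 + \<epsilon> * pullback p q H z) / (2 * pi * weight p q z) * lambda0 h v + factor_deriv p q H \<epsilon> F' z h * lambda0 z v)" for v
    by (rule frechet_derivative_at[symmetric])
  have anti: "lambda0 v u = - lambda0 u v"
    by (simp add: lambda0_eq inner_prod_def inner_complex_def algebra_simps)
  define k where "k = (1 + \<epsilon> * pullback p q H z) / (2 * pi * weight p q z)"
  show ?thesis
    unfolding ext_deriv_def fd anti k_def[symmetric] by (simp add: algebra_simps)
qed

lemma ext_deriv_linear:
  assumes "p > 0" "q > 0" "z \<noteq> 0" "(pullback p q H has_derivative F') (at z)"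
  shows "ext_deriv (lambda_pqe p q H \<epsilon>) z (a *\<^sub>R u) v = a * ext_deriv (lambda_pqe p q H \<epsilon>) z u v"
    and "ext_deriv (lambda_pqe p q H \<epsilon>) z (u - u') v = ext_deriv (lambda_pqe p q H \<epsilon>) z u v - ext_deriv (lambda_pqe p q H \<epsilon>) z u' v"
    and "ext_deriv (lambda_pqe p q H \<epsilon>) z v u = - ext_deriv (lambda_pqe p q H \<epsilon>) z u v"
proof -
  have lin: "linear F'" using assms(4) has_derivative_linear by blast
  have l: "factor_deriv p q H \<epsilon> F' z (a *\<^sub>R u) = a * factor_deriv p q H \<epsilon> F' z u"
    "factor_deriv p q H \<epsilon> F' z (u - u') = factor_deriv p q H \<epsilon> F' z u - factor_deriv p q H \<epsilon> F' z u'"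
    by (simp_all add: factor_deriv_def linear_diff[OF lin] linear_scale[OF lin] inner_diff_right diff_divide_distrib add_divide_distrib algebra_simps)
  define k where "k = (1 + \<epsilon> * pullback p q H z) / (2 * pi * weight p q z)"
  have s: "lambda0 (a *\<^sub>R u) v = a * lambda0 u v" "lambda0 z (a *\<^sub>R u) = a * lambda0 z u"
    "lambda0 (u - u') v = lambda0 u v - lambda0 u' v" "lambda0 z (u - u') = lambda0 z u - lambda0 z u'"
    "lambda0 v u = - lambda0 u v"
    by (simp_all add: lambda0_eq inner_prod_def inner_complex_def algebra_simps)
  show "ext_deriv (lambda_pqe p q H \<epsilon>) z (a *\<^sub>R u) v = a * ext_deriv (lambda_pqe p q H \<epsilon>) z u v"
    "ext_deriv (lambda_pqe p q H \<epsilon>) z (u - u') v = ext_deriv (lambda_pqe p q H \<epsilon>) z u v - ext_deriv (lambda_pqe p q H \<epsilon>) z u' v"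
    "ext_deriv (lambda_pqe p q H \<epsilon>) z v u = - ext_deriv (lambda_pqe p q H \<epsilon>) z u v"
    unfolding ext_deriv_lambda_pqe[OF assms] l s k_def[symmetric] by (simp_all add: algebra_simps)
qed

text \<open>Where the derivative of the pullback vanishes, the perturbed form and its exterior derivative are
\<open>1 + \<epsilon> H\<close> times those of \<open>lambda_pq\<close>, whose Reeb vector field generates the action.\<close>

lemma critical_reeb_vector:
  assumes pq: "p > 0" "q > 0" and z: "z \<in> S3" and F: "(pullback p q H has_derivative F') (at z)"
    and crit: "\<And>w. w \<in> tangent_S3 z \<Longrightarrow> F' w = 0" and m: "1 + \<epsilon> * pullback p q H z \<noteq> 0"
  shows "is_reeb_vector (lambda_pqe p q H \<epsilon>) z ((1 / (1 + \<epsilon> * pullback p q H z)) *\<^sub>R orbit_direction p q z)"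
proof -
  let ?R = "orbit_direction p q z" and ?m = "1 + \<epsilon> * pullback p q H z"
  have z0: "z \<noteq> 0" using z by auto
  have W: "weight p q z > 0" by (rule weight_pos[OF pq z0])
  have "ext_deriv (lambda_pqe p q H \<epsilon>) z ?R w = 0" if w: "w \<in> tangent_S3 z" for w
  proof -
    have "fst z \<bullet> fst ?R = 0" "snd z \<bullet> snd ?R = 0"
      by (simp_all add: orbit_direction_def inner_complex_def)
    then have R0: "factor_deriv p q H \<epsilon> F' z ?R = 0"
      using crit[OF orbit_direction_tangent] by (simp add: factor_deriv_def)
    define X where "X = real p * (fst z \<bullet> fst w) + real q * (snd z \<bullet> snd w)"
    have lR: "lambda0 ?R w = - (2 * pi * X)"
      by (simp add: lambda0_eq orbit_direction_def X_def inner_prod_def inner_complex_def algebra_simps)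
    have fw: "factor_deriv p q H \<epsilon> F' z w = - (?m * (2 * X) / (2 * pi * (weight p q z)\<^sup>2))"
      using crit[OF w] by (simp add: factor_deriv_def X_def algebra_simps)
    have "m * (2 * x) / (2 * pi * y\<^sup>2) * (2 * pi * y) = 2 * (m / (2 * pi * y)) * (2 * pi * x)"
      if "y > 0" for m x y :: real
      using that by (simp add: power2_eq_square)
    note A = this[OF W, of ?m X]
    have B: "0 * l - (- a) * y + k * (- x) = 0" if "a * y = k * x" for a k l x y :: real
      using that by simp
    show ?thesis
      unfolding ext_deriv_lambda_pqe[OF pq z0 F] lambda0_orbit_direction R0 lR fw by (rule B[OF A])
  qed
  moreover have "lambda_pqe p q H \<epsilon> z ((1 / ?m) *\<^sub>R ?R) = 1"
  proof -
    have "lambda0 z ((1 / ?m) *\<^sub>R ?R) = 2 * pi * weight p q z / ?m"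
      using lambda0_orbit_direction[of z p q] by (simp add: lambda0_eq)
    then show ?thesis using W m by (simp add: lambda_pqe_eq)
  qed
  moreover have "(1 / ?m) *\<^sub>R ?R \<in> tangent_S3 z"
    using orbit_direction_tangent[of p q z] by (simp add: tangent_S3_def)
  ultimately show ?thesis
    by (simp add: is_reeb_vector_def ext_deriv_linear(1)[OF pq z0 F])
qed

text \<open>On unit vectors \<open>z\<close>, the inverse of the coordinates \<open>frame z\<close>.\<close>

definition unframe :: "C2 \<Rightarrow> real \<Rightarrow> real \<Rightarrow> real \<Rightarrow> C2" where
  "unframe z a b c = a *\<^sub>R (\<i> * fst z, \<i> * snd z) + b *\<^sub>R (- cnj (snd z), cnj (fst z))
     + c *\<^sub>R (- \<i> * cnj (snd z), \<i> * cnj (fst z))"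

lemma unframe_tangent: "unframe z a b c \<in> tangent_S3 z"
  by (simp add: tangent_S3_def unframe_def inner_prod_def inner_complex_def algebra_simps)

lemma frame_unframe: "frame z (unframe z a b c) = (z \<bullet> z) *\<^sub>R vector [a, b, c]"
  by (simp add: frame_def unframe_def vec_eq_iff forall_3 inner_prod_def inner_complex_def algebra_simps)

lemma positive_tangent_frame:
  assumes z: "z \<in> S3" and w: "w \<in> tangent_S3 z" "w \<noteq> 0"
  obtains u v where "u \<in> tangent_S3 z" "v \<in> tangent_S3 z" "det4 z w u v > 0"
proof -
  have n: "norm z = 1" and zz: "z \<bullet> z = 1" using z by (auto simp: norm_eq_1)
  have "norm (frame z w) = norm w"
    using n w by (intro norm_frame) (auto simp: tangent_S3_def inner_commute)
  then have f: "frame z w \<noteq> 0" using w by auto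
  have d: "det4 z w u v = triple (frame z w) (frame z u) (frame z v)" for u v
    by (simp add: det4_frame zz)
  define a b c where "a = frame z w $ 1" and "b = frame z w $ 2" and "c = frame z w $ 3"
  consider "a \<noteq> 0" | "b \<noteq> 0" | "c \<noteq> 0"
    using f by (auto simp: a_def b_def c_def vec_eq_iff forall_3)
  then show ?thesis
  proof cases
    case 1
    then have "det4 z w (unframe z 0 1 0) (unframe z 0 0 a) > 0"
      unfolding d frame_unframe zz by (auto simp: triple_explicit a_def zero_less_mult_iff)
    then show ?thesis using that unframe_tangent by blast
  next
    case 2
    then have "det4 z w (unframe z 0 0 1) (unframe z b 0 0) > 0"
      unfolding d frame_unframe zz by (auto simp: triple_explicit b_def zero_less_mult_iff)
    then show ?thesis using that unframe_tangent by blast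
  next
    case 3
    then have "det4 z w (unframe z 1 0 0) (unframe z 0 c 0) > 0"
      unfolding d frame_unframe zz by (auto simp: triple_explicit c_def zero_less_mult_iff)
    then show ?thesis using that unframe_tangent by blast
  qed
qed

lemma contact_form_nonzero:
  assumes "contact_form lam" "z \<in> S3"
  shows "\<exists>w. lam z w \<noteq> 0"
proof (rule ccontr)
  assume "\<not> ?thesis"
  then have zero: "lam z w = 0" for w by blast
  have "unframe z 1 0 0 \<noteq> 0"
  proof
    assume "unframe z 1 0 0 = 0"
    then have "\<i> * fst z = 0" "\<i> * snd z = 0" by (simp_all add: unframe_def zero_prod_def)
    then have "z = 0" by (simp add: prod_eq_iff)
    with assms(2) show False by simp
  qed
  then obtain u v where "u \<in> tangent_S3 z" "v \<in> tangent_S3 z" "det4 z (unframe z 1 0 0) u v > 0"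
    using positive_tangent_frame[OF assms(2) unframe_tangent] by blast
  with assms unframe_tangent[of z 1 0 0]
  have "0 < lam z (unframe z 1 0 0) * ext_deriv lam z u v + lam z u * ext_deriv lam z v (unframe z 1 0 0)
      + lam z v * ext_deriv lam z (unframe z 1 0 0) u"
    unfolding contact_form_def by blast
  then show False by (simp add: zero)
qed

text \<open>If the factor were not positive, it would vanish for \<open>\<epsilon>\<close> or some smaller value, and then so would
the form at \<open>z\<close>, although it is a contact form for all small \<open>\<epsilon>\<close>.\<close>

lemma factor_positive:
  assumes "action_threshold p q H L \<epsilon>\<^sub>L" "0 < \<epsilon>" "\<epsilon> < \<epsilon>\<^sub>L" "z \<in> S3"
  shows "1 + \<epsilon> * pullback p q H z > 0"
proof (rule ccontr)
  assume "\<not> ?thesis"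
  then have le: "\<epsilon> * pullback p q H z \<le> -1" by simp
  then have neg: "pullback p q H z < 0"
    using assms(2) by (smt (verit) mult_nonneg_nonneg)
  \<comment> \<open>The value of \<open>\<epsilon>\<close> for which the factor vanishes at \<open>z\<close>.\<close>
  define e where "e = -1 / pullback p q H z"
  have "0 < e" using neg by (simp add: e_def divide_neg_neg)
  moreover have "e \<le> \<epsilon>" using neg le by (simp add: e_def divide_simps mult.commute)
  ultimately have "contact_form (lambda_pqe p q H e)"
    using assms by (auto simp: action_threshold_def)
  moreover have "1 + e * pullback p q H z = 0" using neg by (simp add: e_def)
  then have "lambda_pqe p q H e z w = 0" for w by (simp add: lambda_pqe_def)
  ultimately show False using contact_form_nonzero assms(4) by blast
qed

text \<open>The difference \<open>w\<close> of two Reeb vectors is annihilated by the form and by its exterior derivative, so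
that the contact condition fails on any frame containing \<open>w\<close>.\<close>

lemma reeb_vector_unique:
  assumes pq: "p > 0" "q > 0" and z: "z \<in> S3" and F: "(pullback p q H has_derivative F') (at z)"
    and contact: "contact_form (lambda_pqe p q H \<epsilon>)"
    and R: "is_reeb_vector (lambda_pqe p q H \<epsilon>) z R" and R': "is_reeb_vector (lambda_pqe p q H \<epsilon>) z R'"
  shows "R = R'"
proof (rule ccontr)
  let ?l = "lambda_pqe p q H \<epsilon>"
  assume "R \<noteq> R'"
  define w where "w = R - R'"
  have z0: "z \<noteq> 0" using z by auto
  have w: "w \<noteq> 0" "w \<in> tangent_S3 z"
    using \<open>R \<noteq> R'\<close> R R' by (auto simp: w_def is_reeb_vector_def tangent_S3_def inner_diff_right)
  then obtain u v where uv: "u \<in> tangent_S3 z" "v \<in> tangent_S3 z" "det4 z w u v > 0"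
    using positive_tangent_frame[OF z] by blast
  have "?l z w = ?l z R - ?l z R'"
    by (simp add: lambda_pqe_eq lambda0_eq w_def inner_diff_right algebra_simps)
  then have lw: "?l z w = 0" using R R' by (simp add: is_reeb_vector_def)
  have dw: "ext_deriv ?l z w x = 0" if "x \<in> tangent_S3 z" for x
    using R R' that unfolding w_def ext_deriv_linear(2)[OF pq z0 F] by (simp add: is_reeb_vector_def)
  have "ext_deriv ?l z v w = 0"
    by (subst ext_deriv_linear(3)[OF pq z0 F]) (simp add: dw[OF uv(2)])
  moreover have "0 < ?l z w * ext_deriv ?l z u v + ?l z u * ext_deriv ?l z v w + ?l z v * ext_deriv ?l z w u"
    using contact z w(2) uv unfolding contact_form_def by blast
  ultimately show False using lw dw[OF uv(1)] by simp
qed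

section \<open>Reeb orbits over the critical points\<close>

text \<open>The situation of the theorem, apart from the current.\<close>

locale perturbed_contact_form =
  fixes p q :: nat and H :: "C2 set \<Rightarrow> real" and b h :: "C2 set" and L \<epsilon>\<^sub>L \<epsilon> :: real
  assumes p_pos: "p > 0" and q_pos: "q > 0" and coprime_pq: "coprime p q"
    and morse_smale: "four_point_morse_smale p q H b h"
    and threshold: "action_threshold p q H L \<epsilon>\<^sub>L"
    and eps: "0 < \<epsilon>" "\<epsilon> < \<epsilon>\<^sub>L"
begin

abbreviation lam :: one_form where "lam \<equiv> lambda_pqe p q H \<epsilon>"

text \<open>Over \<open>K\<close> the Reeb flow is the circle action slowed down by this factor.\<close>

definition speed_factor :: "C2 set \<Rightarrow> real" where "speed_factor K = 1 + \<epsilon> * H K"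

lemma pullback_has_derivative:
  assumes "z \<in> S3"
  shows "(pullback p q H has_derivative frechet_derivative (pullback p q H) (at z)) (at z)"
  using morse_smale assms
  by (intro smooth_pullback_differentiable) (auto simp: four_point_morse_smale_def orbifold_morse_smale_def)

lemma critical_point_fiber:
  assumes "K \<in> critical_points p q H" "z \<in> K"
  shows "K = fiber p q z" "z \<in> S3" "pullback p q H z = H K"
proof -
  have "K \<in> CP1 p q" using assms by (simp add: critical_points_def)
  from CP1_fiber[OF this assms(2)] show "K = fiber p q z" "z \<in> S3" by auto
  then show "pullback p q H z = H K" by (simp add: pullback_S3)
qed

lemma speed_factor_pos:
  assumes "K \<in> critical_points p q H" "z \<in> K"
  shows "speed_factor K > 0"
  using factor_positive[OF threshold eps critical_point_fiber(2)[OF assms]] critical_point_fiber(3)[OF assms]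
  by (simp add: speed_factor_def)

lemma critical_point_reeb_vector:
  assumes K: "K \<in> critical_points p q H" and z: "z \<in> K"
  shows "is_reeb_vector lam z ((1 / speed_factor K) *\<^sub>R orbit_direction p q z)"
proof -
  note zK = critical_point_fiber[OF K z]
  have z0: "z \<noteq> 0" using zK(2) by auto
  have "frechet_derivative (pullback p q H) (at z) v = 0" if "v \<in> contact_plane lambda0 z" for v
    using K z that by (auto simp: critical_points_def)
  from critical_derivative_zero[OF p_pos q_pos z0 pullback_has_derivative[OF zK(2)] this]
  have "is_reeb_vector lam z ((1 / (1 + \<epsilon> * pullback p q H z)) *\<^sub>R orbit_direction p q z)"
    using speed_factor_pos[OF K z]
    by (intro critical_reeb_vector[OF p_pos q_pos zK(2) pullback_has_derivative[OF zK(2)]])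
       (auto simp: zK(3) speed_factor_def)
  then show ?thesis by (simp add: zK(3) speed_factor_def)
qed

lemma reeb_trajectory_over_critical_point:
  assumes K: "K \<in> critical_points p q H" and \<gamma>: "reeb_trajectory lam \<gamma>" and range: "\<And>t. \<gamma> t \<in> K"
  shows "\<gamma> t = act p q (cis (2 * pi * (t / speed_factor K))) (\<gamma> 0)"
proof -
  let ?m = "speed_factor K"
  have contact: "contact_form lam" using threshold eps by (auto simp: action_threshold_def)
  have d\<gamma>: "(\<gamma> has_vector_derivative (1 / ?m) *\<^sub>R orbit_direction p q (\<gamma> t)) (at t)" for t
  proof -
    obtain R where R: "is_reeb_vector lam (\<gamma> t) R" "(\<gamma> has_vector_derivative R) (at t)"
      using \<gamma> unfolding reeb_trajectory_def by blast
    have z: "\<gamma> t \<in> S3" using critical_point_fiber(2)[OF K range] .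
    have "R = (1 / ?m) *\<^sub>R orbit_direction p q (\<gamma> t)"
      by (rule reeb_vector_unique[OF p_pos q_pos z pullback_has_derivative[OF z] contact R(1)
            critical_point_reeb_vector[OF K range]])
    with R(2) show ?thesis by simp
  qed
  \<comment> \<open>Both coordinates of \<open>\<gamma>\<close> solve a linear equation; rotating back makes them constant.\<close>
  have const: "cis (- (2 * pi * real n / ?m) * t) * f (\<gamma> t) = f (\<gamma> 0)"
    if f: "bounded_linear f" and ff: "\<And>z. f (orbit_direction p q z) = (2 * pi * real n) *\<^sub>R (\<i> * f z)"
    for f :: "C2 \<Rightarrow> complex" and n :: nat
  proof -
    let ?g = "\<lambda>t. cis (- (2 * pi * real n / ?m) * t) * f (\<gamma> t)"
    have df: "((\<lambda>t. f (\<gamma> t)) has_vector_derivative (1 / ?m) *\<^sub>R ((2 * pi * real n) *\<^sub>R (\<i> * f (\<gamma> t)))) (at t)" for t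
      using bounded_linear.has_vector_derivative[OF f d\<gamma>[of t]]
      unfolding linear_scale[OF bounded_linear.linear[OF f]] ff .
    have dc: "((\<lambda>t. cis (a * t)) has_vector_derivative a *\<^sub>R (\<i> * cis (a * t))) (at t)" for a t
      unfolding has_vector_derivative_def
      by (rule derivative_eq_intros refl)+ (simp add: scaleR_conv_of_real mult_ac)
    have aux: "c * ((1 / ?m) *\<^sub>R (a *\<^sub>R (\<i> * w))) + (- (a / ?m)) *\<^sub>R (\<i> * c) * w = 0" for a and c w :: complex
      by (simp add: scaleR_conv_of_real mult_ac)
    have dg: "(?g has_vector_derivative 0) (at t)" for t
      using has_vector_derivative_mult[OF dc[of "- (2 * pi * real n / ?m)" t] df[of t]] unfolding aux .
    obtain c where c: "\<And>t. t \<in> UNIV \<Longrightarrow> ?g t = c"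
    proof (rule has_vector_derivative_zero_constant[OF convex_UNIV dg])
      fix c assume "\<And>t. t \<in> UNIV \<Longrightarrow> ?g t = c"
      then show thesis by (rule that)
    qed
    have "?g t = ?g 0" unfolding c[OF UNIV_I] ..
    then show ?thesis by simp
  qed
  have e: "cis (2 * pi * (t / ?m)) ^ n * (cis (- (2 * pi * real n / ?m) * t) * w) = w" for n w
  proof -
    have "cis (2 * pi * (t / ?m)) ^ n * cis (- (2 * pi * real n / ?m) * t) = cis 0"
      unfolding Complex.DeMoivre cis_mult by (rule arg_cong[of _ _ cis]) simp
    then show ?thesis by (simp only: mult.assoc[symmetric] cis_zero mult_1_left)
  qed
  have f: "cis (- (2 * pi * real p / ?m) * t) * fst (\<gamma> t) = fst (\<gamma> 0)"
    "cis (- (2 * pi * real q / ?m) * t) * snd (\<gamma> t) = snd (\<gamma> 0)"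
    by (rule const[OF bounded_linear_fst], simp add: orbit_direction_def)
       (rule const[OF bounded_linear_snd], simp add: orbit_direction_def)
  show ?thesis
    unfolding act_def prod_eq_iff fst_conv snd_conv
    using e[of p "fst (\<gamma> t)", unfolded f] e[of q "snd (\<gamma> t)", unfolded f] by simp
qed

lemma period_eqI:
  fixes T P :: real
  assumes inj: "inj_on \<gamma> {0..<T}" and T: "T > 0" and P: "P > 0" "\<gamma> P = \<gamma> 0" and int: "T / P \<in> \<int>"
  shows "T = P"
proof (rule ccontr)
  assume "T \<noteq> P"
  obtain n where n: "T / P = of_int n" using int by (auto elim: Ints_cases)
  have "of_int n > (0::real)" using T P n by (metis divide_pos_pos)
  then have "n \<ge> 1" by simp
  moreover have "n \<noteq> 1" using n P \<open>T \<noteq> P\<close> by (auto simp: field_simps)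
  ultimately have "of_int n > (1::real)" by simp
  then have "P < T" using n P by (metis less_divide_eq_1_pos)
  then have "P = 0" using inj_onD[OF inj P(2)] P T by simp
  with P show False by simp
qed

lemma cis_two_pi_eq_1: "cis (2 * pi * x) = 1 \<longleftrightarrow> x \<in> \<int>"
  using cis_eq_iff[of "2 * pi * x" 0] by simp

text \<open>If the isotropy on \<open>K\<close> consists of the \<open>k\<close>-th roots of unity, then \<open>K\<close> closes up after the \<open>k\<close>-th
part of the period of the action.\<close>

lemma simple_period:
  assumes K: "K \<in> critical_points p q H" and \<gamma>: "reeb_param lam K \<gamma> T" and k: "k > 0"
    and iso: "\<And>x z. z \<in> K \<Longrightarrow> act p q (cis (2 * pi * x)) z = z \<longleftrightarrow> real k * x \<in> \<int>"
  shows "T = speed_factor K / real k"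
proof -
  let ?m = "speed_factor K"
  have r: "\<gamma> t \<in> K" for t using \<gamma> by (auto simp: reeb_param_def)
  have m: "?m > 0" using speed_factor_pos[OF K r] .
  have \<gamma>t: "\<gamma> t = act p q (cis (2 * pi * (t / ?m))) (\<gamma> 0)" for t
    using \<gamma> r by (intro reeb_trajectory_over_critical_point[OF K]) (auto simp: reeb_param_def reeb_orbit_def)
  show ?thesis
  proof (rule period_eqI)
    show "inj_on \<gamma> {0..<T}" "T > 0" using \<gamma> by (auto simp: reeb_param_def reeb_orbit_def)
    show "?m / real k > 0" using m k by simp
    have "act p q (cis (2 * pi * (?m / real k / ?m))) (\<gamma> 0) = \<gamma> 0"
      using m k by (subst iso[OF r]) auto
    then show "\<gamma> (?m / real k) = \<gamma> 0" by (simp only: \<gamma>t[of "?m / real k"])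
    have "\<gamma> T = \<gamma> 0" using \<gamma> by (auto simp: reeb_param_def reeb_orbit_def dest: spec[of _ 0])
    then have "real k * (T / ?m) \<in> \<int>" using iso[OF r, of "T / ?m" 0] \<gamma>t[of T] by simp
    then show "T / (?m / real k) \<in> \<int>" by (simp add: mult.commute)
  qed
qed

lemma nonsingular_isotropy:
  assumes "nonsingular p q K" "z \<in> K"
  shows "act p q (cis (2 * pi * x)) z = z \<longleftrightarrow> real 1 * x \<in> \<int>"
proof -
  have "isotropy p q z = {1}" using assms by (simp add: nonsingular_def)
  then have "cis (2 * pi * x) \<in> isotropy p q z \<longleftrightarrow> cis (2 * pi * x) = 1" by simp
  then show ?thesis by (simp add: isotropy_def cis_two_pi_eq_1)
qed

lemma p_orbit_isotropy:
  assumes "z \<in> p_orbit"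
  shows "act p q (cis (2 * pi * x)) z = z \<longleftrightarrow> real p * x \<in> \<int>"
proof -
  have z: "snd z = 0" "fst z \<noteq> 0" using assms by (auto simp: p_orbit_def norm_prod_def)
  then have "act p q (cis (2 * pi * x)) z = z \<longleftrightarrow> cis (2 * pi * (real p * x)) = 1"
    by (simp add: act_def prod_eq_iff Complex.DeMoivre mult_ac)
  then show ?thesis by (simp only: cis_two_pi_eq_1)
qed

lemma q_orbit_isotropy:
  assumes "z \<in> q_orbit"
  shows "act p q (cis (2 * pi * x)) z = z \<longleftrightarrow> real q * x \<in> \<int>"
proof -
  have z: "fst z = 0" "snd z \<noteq> 0" using assms by (auto simp: q_orbit_def norm_prod_def)
  then have "act p q (cis (2 * pi * x)) z = z \<longleftrightarrow> cis (2 * pi * (real q * x)) = 1"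
    by (simp add: act_def prod_eq_iff Complex.DeMoivre mult_ac)
  then show ?thesis by (simp only: cis_two_pi_eq_1)
qed

text \<open>The current may not contain \<open>b\<close>, so \<open>b\<close> has to be recognized as a Reeb orbit without its help.\<close>

lemma nonsingular_critical_orbit:
  assumes K: "K \<in> critical_points p q H" and ns: "nonsingular p q K"
  shows "embedded_reeb_orbit lam K"
proof -
  obtain z where z: "z \<in> K" using K unfolding critical_points_def CP1_def using fiber_self by blast
  let ?m = "speed_factor K"
  let ?\<gamma> = "\<lambda>t. act p q (cis (2 * pi * (t / ?m))) z"
  note zK = critical_point_fiber[OF K z]
  have m: "?m > 0" by (rule speed_factor_pos[OF K z])
  have in_K: "?\<gamma> t \<in> K" for t unfolding zK(1) fiber_def by (auto intro!: exI[of _ "cis _"])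
  have "reeb_trajectory lam ?\<gamma>"
    unfolding reeb_trajectory_def
    using critical_point_fiber(2)[OF K in_K] critical_point_reeb_vector[OF K in_K] act_has_vector_derivative by blast
  moreover have "?\<gamma> (t + ?m) = ?\<gamma> t" for t
  proof -
    have "cis (2 * pi * ((t + ?m) / ?m)) = cis (2 * pi * (t / ?m))"
      using m by (simp add: cis_eq_iff add_divide_distrib algebra_simps)
    then show ?thesis by simp
  qed
  moreover have "inj_on ?\<gamma> {0..<?m}"
  proof (rule inj_onI)
    fix s t assume st: "s \<in> {0..<?m}" "t \<in> {0..<?m}" and eq: "?\<gamma> s = ?\<gamma> t"
    have "act p q (cis (2 * pi * ((s - t) / ?m))) z = act p q (cis (- (2 * pi * (t / ?m)))) (?\<gamma> s)"
      unfolding act_mult cis_mult by (simp add: diff_divide_distrib algebra_simps)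
    also have "\<dots> = z" unfolding eq act_mult cis_mult by (simp add: act_1)
    finally have "real 1 * ((s - t) / ?m) \<in> \<int>" by (simp only: nonsingular_isotropy[OF ns z])
    then have "(s - t) / ?m \<in> \<int>" by simp
    moreover have "\<bar>(s - t) / ?m\<bar> < 1" using st m by (auto simp: abs_less_iff divide_less_eq)
    ultimately have "(s - t) / ?m = 0" using Ints_nonzero_abs_less1 by blast
    then show "s = t" using m by simp
  qed
  moreover have "range ?\<gamma> = K"
  proof
    show "K \<subseteq> range ?\<gamma>"
    proof
      fix w assume "w \<in> K"
      then obtain c where c: "norm c = 1" "w = act p q c z" unfolding zK(1) fiber_def by blast
      have "c = cis (Arg c)" using rcis_cmod_Arg[of c] c by (simp add: rcis_def)
      then have "w = ?\<gamma> (?m * (Arg c / (2 * pi)))" using c m by simp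
      then show "w \<in> range ?\<gamma>" by blast
    qed
  qed (use in_K in auto)
  ultimately have "reeb_param lam K ?\<gamma> ?m" using m by (simp add: reeb_param_def reeb_orbit_def)
  then show ?thesis unfolding embedded_reeb_orbit_def by blast
qed

end

lemma some_param_works:
  assumes "embedded_reeb_orbit lam K" "some_param lam K = (\<gamma>, T)"
  shows "reeb_param lam K \<gamma> T"
proof -
  have "case some_param lam K of (\<gamma>, T) \<Rightarrow> reeb_param lam K \<gamma> T"
    unfolding some_param_def
    using assms(1) unfolding embedded_reeb_orbit_def by (intro someI_ex[of "\<lambda>(\<gamma>, T). reeb_param lam K \<gamma> T"]) auto
  with assms(2) show ?thesis by simp
qed

lemma action_eq_period:
  assumes "reeb_orbit lam \<gamma> T"
  shows "action lam \<gamma> T = T"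
proof -
  have "lam (\<gamma> t) (vector_derivative \<gamma> (at t)) = 1" for t
    using assms unfolding reeb_orbit_def reeb_trajectory_def is_reeb_vector_def
    by (metis vector_derivative_at)
  then show ?thesis using assms by (simp add: action_def reeb_orbit_def)
qed

lemma orbit_action_pos:
  assumes "embedded_reeb_orbit lam K"
  shows "orbit_action lam K > 0"
proof -
  obtain \<gamma> T where s: "some_param lam K = (\<gamma>, T)" by fastforce
  have "reeb_orbit lam \<gamma> T" using some_param_works[OF assms s] by (simp add: reeb_param_def)
  then show ?thesis using s by (simp add: orbit_action_def action_eq_period) (simp add: reeb_orbit_def)
qed

lemma orbit_action_le_current_action:
  assumes "reeb_current lam \<Gamma>" "K \<in># \<Gamma>"
  shows "orbit_action lam K \<le> current_action lam \<Gamma>"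
proof -
  obtain \<Delta> where \<Delta>: "\<Gamma> = add_mset K \<Delta>" using assms(2) by (metis multi_member_split)
  have "(\<Sum>K\<in>#\<Delta>. orbit_action lam K) \<ge> 0"
    using assms(1) unfolding reeb_current_def \<Delta>
    by (induction \<Delta>) (auto intro!: add_nonneg_nonneg less_imp_le[OF orbit_action_pos])
  then show ?thesis by (simp add: current_action_def \<Delta>)
qed

context perturbed_contact_form
begin

lemma b_critical: "b \<in> critical_points p q H" "nonsingular p q b"
  and h_critical: "h \<in> critical_points p q H" "nonsingular p q h"
  and p_orbit_critical: "p_orbit \<in> critical_points p q H"
  and q_orbit_critical: "q_orbit \<in> critical_points p q H"
  and critical_points_eq: "critical_points p q H = {b, h, p_orbit, q_orbit}"
  using morse_smale by (auto simp: four_point_morse_smale_def)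

lemma critical_points_distinct:
  "h \<noteq> b" "p_orbit \<noteq> b" "q_orbit \<noteq> b" "h \<noteq> p_orbit" "h \<noteq> q_orbit" "p_orbit \<noteq> q_orbit"
  using morse_smale by (auto simp: four_point_morse_smale_def card_insert_if split: if_splits)

text \<open>This is what the bound \<open>\<epsilon>\<^sub>L\<close> is chosen for.\<close>

lemma orbit_over_critical_point:
  assumes "embedded_reeb_orbit lam K" "orbit_action lam K < L"
  shows "K \<in> critical_points p q H"
proof -
  obtain \<gamma> T where s: "some_param lam K = (\<gamma>, T)" by fastforce
  have param: "reeb_param lam K \<gamma> T" by (rule some_param_works[OF assms(1) s])
  then have "reeb_orbit lam \<gamma> T" "action lam \<gamma> T < L" "range \<gamma> = K"
    using assms(2) s by (auto simp: reeb_param_def orbit_action_def)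
  then show ?thesis using threshold eps unfolding action_threshold_def by blast
qed

lemma param_knot_curve:
  assumes K: "K \<in> critical_points p q H" and \<gamma>: "reeb_param lam K \<gamma> T"
  obtains A where "fst A \<in> {0..pi/2}" "\<gamma> = (\<lambda>t. knot_curve p q A (t / speed_factor K))"
proof -
  have r: "\<gamma> t \<in> K" for t using \<gamma> by (auto simp: reeb_param_def)
  obtain A where A: "fst A \<in> {0..pi/2}" "knot_curve p q A 0 = \<gamma> 0"
    using knot_curve_polar[OF critical_point_fiber(2)[OF K r]] by blast
  have "\<gamma> t = knot_curve p q A (t / speed_factor K)" for t
    using reeb_trajectory_over_critical_point[of K \<gamma> t, OF K _ r] \<gamma> act_knot_curve[of p q "t / speed_factor K" A]
    by (simp add: A(2) reeb_param_def reeb_orbit_def)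
  then show ?thesis using that A by blast
qed

lemma orbit_linking_critical:
  assumes K: "K \<in> critical_points p q H" "K \<noteq> b" "embedded_reeb_orbit lam K" and k: "k > 0"
    and iso: "\<And>x z. z \<in> K \<Longrightarrow> act p q (cis (2 * pi * x)) z = z \<longleftrightarrow> real k * x \<in> \<int>"
  shows "orbit_linking lam K b = real (p * q) / real k"
proof -
  obtain \<gamma> S where s: "some_param lam K = (\<gamma>, S)" by fastforce
  obtain \<eta> T where t: "some_param lam b = (\<eta>, T)" by fastforce
  have \<gamma>: "reeb_param lam K \<gamma> S" by (rule some_param_works[OF K(3) s])
  have \<eta>: "reeb_param lam b \<eta> T"
    by (rule some_param_works[OF nonsingular_critical_orbit[OF b_critical] t])
  let ?m = "speed_factor K" and ?n = "speed_factor b"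
  have S: "S = ?m / real k" by (rule simple_period[OF K(1) \<gamma> k iso])
  have T: "T = ?n" using simple_period[OF b_critical(1) \<eta> zero_less_one nonsingular_isotropy[OF b_critical(2)]] by simp
  obtain A where A: "fst A \<in> {0..pi/2}" "\<gamma> = (\<lambda>t. knot_curve p q A (t / ?m))"
    using param_knot_curve[OF K(1) \<gamma>] by blast
  obtain B where B: "fst B \<in> {0..pi/2}" "\<eta> = (\<lambda>t. knot_curve p q B (t / ?n))"
    using param_knot_curve[OF b_critical(1) \<eta>] by blast
  have r: "\<gamma> t \<in> K" "\<eta> t \<in> b" for t using \<gamma> \<eta> by (auto simp: reeb_param_def)
  have m: "?m > 0" "?n > 0" using speed_factor_pos[OF K(1) r(1)] speed_factor_pos[OF b_critical(1) r(2)] .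
  have rA: "knot_curve p q A s \<in> K" "knot_curve p q B s \<in> b" for s
    using r(1)[of "s * ?m"] r(2)[of "s * ?n"] m unfolding A(2) B(2) by auto
  have dis: "knot_curve p q A s \<noteq> knot_curve p q B t" for s t
    using critical_point_fiber(1)[OF K(1) rA(1)] critical_point_fiber(1)[OF b_critical(1) rA(2)] K(2) by metis
  have per: "knot_curve p q A (s + 1 / real k) = knot_curve p q A s" for s
  proof -
    have "\<gamma> (s * ?m + S) = \<gamma> (s * ?m)" using \<gamma> by (simp add: reeb_param_def reeb_orbit_def)
    moreover have "(s * ?m + S) / ?m = s + 1 / real k" using m unfolding S by (simp add: add_divide_distrib)
    ultimately show ?thesis using m unfolding A(2) by simp
  qed
  show ?thesis
    unfolding orbit_linking_def s t prod.case S T A(2) B(2)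
    by (rule linking_number_knot_curves[OF p_pos q_pos coprime_pq A(1) B(1) dis k per m])
qed

lemma orbit_linking_values:
  shows "embedded_reeb_orbit lam h \<Longrightarrow> orbit_linking lam h b = real (p * q)"
    and "embedded_reeb_orbit lam p_orbit \<Longrightarrow> orbit_linking lam p_orbit b = real q"
    and "embedded_reeb_orbit lam q_orbit \<Longrightarrow> orbit_linking lam q_orbit b = real p"
proof -
  note ne = critical_points_distinct
  show "orbit_linking lam h b = real (p * q)" if "embedded_reeb_orbit lam h"
    using orbit_linking_critical[OF h_critical(1) ne(1) that zero_less_one nonsingular_isotropy[OF h_critical(2)]] by simp
  show "orbit_linking lam p_orbit b = real q" if "embedded_reeb_orbit lam p_orbit"
    using orbit_linking_critical[OF p_orbit_critical ne(2) that p_pos p_orbit_isotropy] p_pos by simp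
  show "orbit_linking lam q_orbit b = real p" if "embedded_reeb_orbit lam q_orbit"
    using orbit_linking_critical[OF q_orbit_critical ne(3) that q_pos q_orbit_isotropy] q_pos by simp
qed

lemma current_linking:
  assumes "reeb_current lam \<alpha>" "set_mset \<alpha> \<subseteq> {h, p_orbit, q_orbit}"
  shows "(\<Sum>K\<in>#\<alpha>. orbit_linking lam K b) = real (degree p q b h \<alpha>)"
  using assms
proof (induction \<alpha>)
  case empty
  then show ?case by (simp add: degree_def)
next
  case (add K \<alpha>)
  have IH: "(\<Sum>K\<in>#\<alpha>. orbit_linking lam K b) = real (degree p q b h \<alpha>)"
    using add by (auto simp: reeb_current_def)
  note ne = critical_points_distinct
  have "embedded_reeb_orbit lam K" using add.prems by (simp add: reeb_current_def)
  moreover have "K = h \<or> K = p_orbit \<or> K = q_orbit" using add.prems by auto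
  ultimately show ?case
    using IH ne ne[symmetric] orbit_linking_values
    by (elim disjE) (simp_all add: degree_def algebra_simps)
qed

end

theorem proposition6p12:
  fixes p q B :: nat and H :: "C2 set \<Rightarrow> real" and b h :: "C2 set"
    and L \<epsilon>\<^sub>L \<epsilon> \<delta> :: real and \<alpha> :: "C2 set multiset"
  assumes "p > 0" and "q > 0" and "coprime p q"
    and "four_point_morse_smale p q H b h"
    and "L > 0" and "action_threshold p q H L \<epsilon>\<^sub>L"
    and "0 < \<epsilon>" and "\<epsilon> < \<epsilon>\<^sub>L"
    and "\<delta> > 0" and "\<delta> \<notin> \<rat>"
    and "rotation_number (lambda_pqe p q H \<epsilon>) b = real (p * q) + \<delta>"
    and "reeb_current (lambda_pqe p q H \<epsilon>) \<alpha>" and "b \<notin># \<alpha>"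
    and "current_action (lambda_pqe p q H \<epsilon>) (replicate_mset B b + \<alpha>) < L"
  shows "knot_filtration (lambda_pqe p q H \<epsilon>) b (replicate_mset B b + \<alpha>)
           = real (degree p q b h (replicate_mset B b + \<alpha>)) + real B * \<delta>"
proof -
  interpret perturbed_contact_form p q H b h L \<epsilon>\<^sub>L \<epsilon>
    using assms by unfold_locales
  let ?\<Gamma> = "replicate_mset B b + \<alpha>"
  have current: "reeb_current lam ?\<Gamma>"
    using assms(12) nonsingular_critical_orbit[OF b_critical] by (auto simp: reeb_current_def)
  have "K \<in> {h, p_orbit, q_orbit}" if "K \<in># \<alpha>" for K
  proof -
    have "orbit_action lam K < L"
      using orbit_action_le_current_action[OF current, of K] that assms(14) by simp
    then have "K \<in> critical_points p q H"
      using orbit_over_critical_point assms(12) that by (auto simp: reeb_current_def)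
    then show ?thesis using critical_points_eq that assms(13) by auto
  qed
  then have "(\<Sum>K\<in>#\<alpha>. orbit_linking lam K b) = real (degree p q b h \<alpha>)"
    using assms(12) by (intro current_linking) auto
  moreover have "filter_mset (\<lambda>K. K \<noteq> b) ?\<Gamma> = \<alpha>"
    using assms(13) by (auto simp: multiset_eq_iff not_in_iff)
  moreover have "count ?\<Gamma> b = B" using assms(13) by (simp add: not_in_iff)
  moreover have "degree p q b h ?\<Gamma> = p * q * B + degree p q b h \<alpha>"
    using assms(13) critical_points_distinct by (simp add: degree_def algebra_simps)
  ultimately show ?thesis
    using assms(11) by (simp add: knot_filtration_def algebra_simps)
qed

end
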